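(* Assume that for every $n\in\mathbb N$ there are constants $0<m_{2n}\le M_{2n}$ and $M_{2n+1}>0$ such that for all $v\in H$: i) $m_{2n}\|v\|_W^2\le\|B_1^*(t)v\|_{U_1}^2\le M_{2n}\|v\|_W^2$ for $t\in I_{2n}$; ii) $\|B_2^*(t)v\|_{U_2}^2\le M_{2n+1}\|v\|_W^2$ for $t\in I_{2n+1}$; and assume that $\inf_{n\in\mathbb N}\frac{m_{2n}}{M_{2n+1}}>0$. Assume that there is a time $\overline T>0$ such that for every $T>\overline T$ there is a constant $c=c(T)>0$, independent of the initial data, such that $$\frac12\left(\|w_0\|_V^2+\|w_1\|_H^2\right)\le c\int_0^T\|w_t(s)\|_W^2\,ds$$ for every weak solution $w$ of $w_{tt}+Aw=0$, $t>0$, $w(0)=w_0$, $w_t(0)=w_1$ with $(w_0,w_1)\in V\times H$. Assume moreover that $T^*:=\inf_n T_{2n}$ satisfies $T^*>\overline T$ and $T^*\ge\tau$. If $$\sum_{n=0}^\infty M_{2n+1}T_{2n+1}<+\infty\qquad\text{and}\qquad\sum_{n=0}^\infty\frac{m_{2n}}{1+4C^2T_{2n}^2M_{2n}^2}=+\infty,$$ then the delayed problem is asymptotically stable, that is, every solution $u$ of the delayed problem satisfies $E(u;t)\to0$ as $t\to+\infty$.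
   Context: $\mathbb N=\{0,1,2,\dots\}$. $H$ is a real Hilbert space; $A:\mathcal D(A)\to H$ is a positive self-adjoint operator with compact inverse; $V=\mathcal D(A^{1/2})$ with $\|v\|_V=\|A^{1/2}v\|_H$; $V'$ is the dual of $V$ with pivot space $H$. $U_1,U_2$ are real Hilbert spaces, identified with their duals; $\tau>0$ is fixed. $0=t_0<t_1<t_2<\cdots$ is a sequence, $I_n=[t_n,t_{n+1})$, $T_n=t_{n+1}-t_n$, and $T_{2n}\ge\tau$ for all $n$. $B_1(t)\in\mathcal L(U_1,H)$, $B_2(t)\in\mathcal L(U_2,H)$ satisfy, for all $n$: $B_2(t)=0$ for $t\in I_{2n}$, $B_1(t)=0$ for $t\in I_{2n+1}$, $B_1\in C^1([t_{2n},t_{2n+1}];\mathcal L(U_1,H))$ and $B_2\in C([t_{2n+1},t_{2n+2}];\mathcal L(U_2,H))$ (continuity up to the right endpoint is understood as existence of an extension from the half-open interval). $W$ is a Hilbert space in which $H$ is continuously embedded, with $C>0$ such that $\|v\|_W^2\le C\|v\|_H^2$ for all $v\in H$. Delayed problem: $$u_{tt}(t)+Au(t)+B_1(t)B_1^*(t)u_t(t)+B_2(t)B_2^*(t)u_t(t-\tau)=0,\ t>0,\qquad u(0)=u_0\in V,\ u_t(0)=u_1\in H.$$ The delay term is $0$ whenever $B_2(t)=0$, in particular on $[0,\tau)$, so no history data are needed. A solution is a mild (equivalently weak, with the equation holding in $V'$) solution $u\in C([0,\infty);V)\cap C^1([0,\infty);H)$. Energy: $$E(t)=E(u;t):=\frac12\left(\|u(t)\|_V^2+\|u_t(t)\|_H^2\right)+\frac{\xi}{2}\int_{t-\tau}^t\|B_2^*(s+\tau)u_t(s)\|_{U_2}^2\,ds,$$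 where $\xi$ is a fixed number with $0<\xi<\inf_{n}\frac{m_{2n}}{M_{2n+1}}$; the integrand is $0$ where $B_2(s+\tau)=0$, in particular for $s<0$. *)

theory Defs
  imports "HOL-Analysis.Analysis"
begin

(* An unbounded operator on H is a pair of a domain D and a function A on H;
   the values of A outside D are never used. *)

definition linear_operator_on :: "'h::real_inner set \<Rightarrow> ('h \<Rightarrow> 'h) \<Rightarrow> bool" where
  "linear_operator_on D A \<longleftrightarrow> subspace D \<and>
     (\<forall>x\<in>D. \<forall>y\<in>D. A (x + y) = A x + A y) \<and>
     (\<forall>x\<in>D. \<forall>c. A (c *\<^sub>R x) = c *\<^sub>R A x)"

(* The last conjunct says that the graph of the Hilbert-space adjoint of (D, A)
   is the graph of (D, A), so the domains agree as well. *)
definition self_adjoint_op :: "'h::real_inner set \<Rightarrow> ('h \<Rightarrow> 'h) \<Rightarrow> bool" where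
  "self_adjoint_op D A \<longleftrightarrow> linear_operator_on D A \<and> closure D = UNIV \<and>
     (\<forall>y z. (\<forall>x\<in>D. inner (A x) y = inner x z) \<longleftrightarrow> (y \<in> D \<and> z = A y))"

definition positive_op :: "'h::real_inner set \<Rightarrow> ('h \<Rightarrow> 'h) \<Rightarrow> bool" where
  "positive_op D A \<longleftrightarrow> (\<forall>x\<in>D. x \<noteq> 0 \<longrightarrow> 0 < inner (A x) x)"

definition has_compact_inverse :: "'h::real_inner set \<Rightarrow> ('h \<Rightarrow> 'h) \<Rightarrow> bool" where
  "has_compact_inverse D A \<longleftrightarrow> bij_betw A D UNIV \<and>
     compact (closure (inv_into D A ` cball 0 1))"

(* (V, S) is the operator A^{1/2}: the positive self-adjoint operator whose square,
   with its natural domain, is (D, A). The norm of v in V is then norm (S v). *)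
definition is_positive_sqrt_op ::
  "'h::real_inner set \<Rightarrow> ('h \<Rightarrow> 'h) \<Rightarrow> 'h set \<Rightarrow> ('h \<Rightarrow> 'h) \<Rightarrow> bool" where
  "is_positive_sqrt_op V S D A \<longleftrightarrow> self_adjoint_op V S \<and> positive_op V S \<and>
     D = {x \<in> V. S x \<in> V} \<and> (\<forall>x\<in>D. A x = S (S x))"

(* u_t on [0,\<infinity>), one-sided at 0. For negative t the value is unspecified. *)
definition time_deriv :: "(real \<Rightarrow> 'h::real_normed_vector) \<Rightarrow> real \<Rightarrow> 'h" where
  "time_deriv u t = vector_derivative u (at t within {0..})"

(* The class C([0,\<infinity>);V) \<inter> C^1([0,\<infinity>);H). *)
definition energy_class ::
  "'h::real_inner set \<Rightarrow> ('h \<Rightarrow> 'h) \<Rightarrow> (real \<Rightarrow> 'h) \<Rightarrow> bool" where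
  "energy_class V S u \<longleftrightarrow>
     (\<forall>t\<ge>0. u t \<in> V) \<and>
     (\<forall>t\<ge>0. ((\<lambda>s. norm (S (u s - u t))) \<longlongrightarrow> 0) (at t within {0..})) \<and>
     (\<forall>t\<ge>0. u differentiable (at t within {0..})) \<and>
     continuous_on {0..} (time_deriv u)"

(* The H-valued f, viewed in V' through the pivot space (h acts as v \<mapsto> <h,v>), has at t
   the derivative F in V'. Convergence in the dual norm is spelled out: the difference of
   the functionals has norm at most e on V. *)
definition has_dual_derivative ::
  "'h::real_inner set \<Rightarrow> ('h \<Rightarrow> 'h) \<Rightarrow> (real \<Rightarrow> 'h) \<Rightarrow> ('h \<Rightarrow> real) \<Rightarrow> real \<Rightarrow> bool" where
  "has_dual_derivative V S f F t \<longleftrightarrow>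
     (\<forall>e>0. \<forall>\<^sub>F s in at t. \<forall>v\<in>V.
        \<bar>inner ((1 / (s - t)) *\<^sub>R (f s - f t)) v - F v\<bar> \<le> e * norm (S v))"

(* w_tt + A w = 0 in V'. For x in V the functional A x in V' is v \<mapsto> <A^{1/2} x, A^{1/2} v>. *)
definition free_wave_solution ::
  "'h::real_inner set \<Rightarrow> ('h \<Rightarrow> 'h) \<Rightarrow> 'h \<Rightarrow> 'h \<Rightarrow> (real \<Rightarrow> 'h) \<Rightarrow> bool" where
  "free_wave_solution V S w0 w1 w \<longleftrightarrow>
     energy_class V S w \<and> w 0 = w0 \<and> time_deriv w 0 = w1 \<and>
     (\<forall>t>0. has_dual_derivative V S (time_deriv w) (\<lambda>v. - inner (S (w t)) (S v)) t)"

(* The equation holds in V' on every open interval between consecutive switching times;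
   at a switching time B1 and B2 may jump, so u_tt need not exist there, and the
   continuity of u_t in H joins the pieces. The unspecified value of u_t at negative
   times is harmless: the delay term vanishes where B2 t = 0. *)
definition delayed_solution ::
  "'h::{real_inner,complete_space} set \<Rightarrow> ('h \<Rightarrow> 'h) \<Rightarrow> real \<Rightarrow> (nat \<Rightarrow> real) \<Rightarrow>
   (real \<Rightarrow> 'u1::{real_inner,complete_space} \<Rightarrow>\<^sub>L 'h) \<Rightarrow>
   (real \<Rightarrow> 'u2::{real_inner,complete_space} \<Rightarrow>\<^sub>L 'h) \<Rightarrow> 'h \<Rightarrow> 'h \<Rightarrow> (real \<Rightarrow> 'h) \<Rightarrow> bool" where
  "delayed_solution V S \<tau> tt B1 B2 u0 u1 u \<longleftrightarrow>
     energy_class V S u \<and> u 0 = u0 \<and> time_deriv u 0 = u1 \<and>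
     (\<forall>t>0. t \<notin> range tt \<longrightarrow>
        has_dual_derivative V S (time_deriv u)
          (\<lambda>v. - inner (S (u t)) (S v)
               - inner (blinfun_apply (B1 t) (adjoint (blinfun_apply (B1 t)) (time_deriv u t))) v
               - inner (blinfun_apply (B2 t) (adjoint (blinfun_apply (B2 t)) (time_deriv u (t - \<tau>)))) v)
          t)"

definition energy ::
  "('h::{real_inner,complete_space} \<Rightarrow> 'h) \<Rightarrow> real \<Rightarrow> real \<Rightarrow>
   (real \<Rightarrow> 'u2::{real_inner,complete_space} \<Rightarrow>\<^sub>L 'h) \<Rightarrow> (real \<Rightarrow> 'h) \<Rightarrow> real \<Rightarrow> real" where
  "energy S \<tau> \<xi> B2 u t =
     1 / 2 * ((norm (S (u t)))\<^sup>2 + (norm (time_deriv u t))\<^sup>2) +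
     \<xi> / 2 * integral {t - \<tau>..t}
       (\<lambda>s. (norm (adjoint (blinfun_apply (B2 (s + \<tau>))) (time_deriv u s)))\<^sup>2)"

(* f, given on [a,b), belongs to C([a,b]) resp. C^1([a,b]): it has such an extension
   to b. The value f b itself plays no role. *)
definition cont_up_to :: "real \<Rightarrow> real \<Rightarrow> (real \<Rightarrow> 'b::real_normed_vector) \<Rightarrow> bool" where
  "cont_up_to a b f \<longleftrightarrow> (\<exists>g. continuous_on {a..b} g \<and> (\<forall>t\<in>{a..<b}. g t = f t))"

definition C1_up_to :: "real \<Rightarrow> real \<Rightarrow> (real \<Rightarrow> 'b::real_normed_vector) \<Rightarrow> bool" where
  "C1_up_to a b f \<longleftrightarrow> (\<exists>g g'.
     (\<forall>t\<in>{a..b}. (g has_vector_derivative g' t) (at t within {a..b})) \<and>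
     continuous_on {a..b} g' \<and> (\<forall>t\<in>{a..<b}. g t = f t))"

definition step_length :: "(nat \<Rightarrow> real) \<Rightarrow> nat \<Rightarrow> real" where
  "step_length tt n = tt (n + 1) - tt n"

end

(* On a damped interval [t_2n, t_2n+1) the energy decreases at rate at least m_2n / 2 times the
   W-norm of the velocity squared: the delay part of the energy is fed only by velocities
   at times t with t + tau in the next interval, and xi * M_2n+1 <= m_2n absorbs them. Comparing u over a
   time T* = inf T_2n with the free wave having the same data turns the observability inequality
   into E(t_2n) <= 4 c (1 + 4 C^2 T*^2 M_2n^2) * (integral of the W-norm of u_t squared), so E
   shrinks by a factor 1 - kappa m_2n / (1 + 4 C^2 T_2n^2 M_2n^2). On a delayed interval Gronwall's
   lemma bounds the growth by exp (K M_2n+1 T_2n+1). The product of these factors tends to 0.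

   Only free waves with data in the span of the eigenvectors of A are needed, since that span is
   dense in V x H; they are explicit finite trigonometric sums. *)
theory Submission
  imports Defs
begin

section \<open>Hilbert spaces\<close>

text \<open>The velocity of a weak solution lies only in H, while the equation is an identity in the
  dual of V, so even the energy identity, the base of every estimate, needs a regularisation. It is
  proved for an arbitrary continuous force, so that it covers the damped wave, the delayed wave and
  the difference from a free wave. The bound T_2n >= \<tau> serves two main purposes. At t_2n the
  delay part of the energy vanishes, so observability controls the whole energy there; and a shift
  by \<tau> cannot jump over an undelayed interval, so that only M_2n+1 has to be balanced against
  m_2n. Observability is used on the one length T* rather than on T_2n, because c depends on the
  length and kappa must not depend on n; replacing T* by T_2n in the denominator only weakens the
  estimate. The constants are kappa = 1/(8c) and K = C (1/\<xi> + \<xi>). Data in the eigenvector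
  span match those of u only up to some delta; the resulting error, of order delta^2, is removed at
  the end of the comparison.\<close>

lemma closest_point_orthogonal:
  fixes E :: "'h::{real_inner,complete_space} set"
  assumes sub: "subspace E" and cl: "closed E"
  obtains p where "p \<in> E" "\<And>y. y \<in> E \<Longrightarrow> (x - p) \<bullet> y = 0"
proof -
  define d where "d = Inf ((\<lambda>y. (norm (x - y))\<^sup>2) ` E)"
  have ne: "E \<noteq> {}" using subspace_0[OF sub] by auto
  have bdd: "bdd_below ((\<lambda>y. (norm (x - y))\<^sup>2) ` E)" by (rule bdd_belowI[of _ 0]) auto
  have dle: "d \<le> (norm (x - y))\<^sup>2" if "y \<in> E" for y
    unfolding d_def using that bdd by (intro cInf_lower) auto
  have "\<exists>y\<in>E. (norm (x - y))\<^sup>2 < d + 1 / real (Suc n)" for n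
  proof -
    have "Inf ((\<lambda>y. (norm (x - y))\<^sup>2) ` E) < d + 1 / real (Suc n)" unfolding d_def by simp
    then show ?thesis using cInf_less_iff[OF _ bdd] ne by auto
  qed
  then obtain f where fE: "\<And>n. f n \<in> E" and fd: "\<And>n. (norm (x - f n))\<^sup>2 < d + 1 / real (Suc n)"
    by metis
  \<comment> \<open>Parallelogram identity for \<open>x - y\<close> and \<open>x - z\<close>: half
    their sum is \<open>x\<close> minus the midpoint, which lies in \<open>E\<close>, so its squared
    norm is at least \<open>d\<close>. Almost minimal points are therefore close together.\<close>
  have par: "(norm (y - z))\<^sup>2 \<le> 2 * ((norm (x - y))\<^sup>2 - d) + 2 * ((norm (x - z))\<^sup>2 - d)"
    if "y \<in> E" "z \<in> E" for y z
  proof -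
    have "(1/2) *\<^sub>R (y + z) \<in> E" using that sub by (simp add: subspace_add subspace_scale)
    then have "d \<le> (norm (x - (1/2) *\<^sub>R (y + z)))\<^sup>2" by (rule dle)
    moreover have "(norm (y - z))\<^sup>2 + 4 * (norm (x - (1/2) *\<^sub>R (y + z)))\<^sup>2
        = 2 * (norm (x - y))\<^sup>2 + 2 * (norm (x - z))\<^sup>2"
      unfolding power2_norm_eq_inner by (simp add: inner_simps inner_commute algebra_simps)
    ultimately show ?thesis by (simp add: algebra_simps)
  qed
  have "Cauchy f"
  proof (rule metric_CauchyI)
    fix e :: real assume e: "e > 0"
    obtain N where N: "1 / real (Suc N) < e\<^sup>2 / 4"
      using reals_Archimedean[of "e\<^sup>2/4"] e by (auto simp: inverse_eq_divide)
    show "\<exists>N. \<forall>m\<ge>N. \<forall>n\<ge>N. dist (f m) (f n) < e"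
    proof (intro exI allI impI)
      fix m n assume mn: "m \<ge> N" "n \<ge> N"
      have q: "(norm (x - f k))\<^sup>2 - d < e\<^sup>2 / 4" if "k \<ge> N" for k
      proof -
        have "1 / real (Suc k) \<le> 1 / real (Suc N)" using that by (simp add: divide_simps)
        then show ?thesis using fd[of k] N by linarith
      qed
      have "(norm (f m - f n))\<^sup>2 \<le> 2 * ((norm (x - f m))\<^sup>2 - d) + 2 * ((norm (x - f n))\<^sup>2 - d)"
        by (rule par[OF fE fE])
      also have "\<dots> < 2 * (e\<^sup>2 / 4) + 2 * (e\<^sup>2 / 4)"
        by (intro add_strict_mono mult_strict_left_mono q mn) auto
      finally have "(norm (f m - f n))\<^sup>2 < e\<^sup>2" by simp
      then show "dist (f m) (f n) < e" using e by (simp add: dist_norm power_less_imp_less_base)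
    qed
  qed
  then obtain p where p: "f \<longlonglongrightarrow> p" using Cauchy_convergent_iff convergent_def by blast
  have pE: "p \<in> E" using closed_sequentially[OF cl] fE p by blast
  have "(norm (x - p))\<^sup>2 \<le> d"
  proof (rule LIMSEQ_le)
    show "(\<lambda>n. (norm (x - f n))\<^sup>2) \<longlonglongrightarrow> (norm (x - p))\<^sup>2" by (intro tendsto_intros p)
    have "(\<lambda>n. d + 1 / real (Suc n)) \<longlonglongrightarrow> d + 0"
      using LIMSEQ_inverse_real_of_nat by (intro tendsto_intros) (auto simp: inverse_eq_divide)
    then show "(\<lambda>n. d + 1 / real (Suc n)) \<longlonglongrightarrow> d" by simp
    show "\<exists>N. \<forall>n\<ge>N. (norm (x - f n))\<^sup>2 \<le> d + 1 / real (Suc n)"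
      using fd less_imp_le by blast
  qed
  have orth: "(x - p) \<bullet> y = 0" if y: "y \<in> E" for y
  proof (cases "y = 0")
    case False
    \<comment> \<open>This \<open>c\<close> minimises the norm of
      \<open>(x - p) - c *\<^sub>R y\<close>; minimality of \<open>p\<close> leaves no room for a
      decrease.\<close>
    define c where "c = (x - p) \<bullet> y / (y \<bullet> y)"
    have yy: "y \<bullet> y > 0" using False by simp
    have "p + c *\<^sub>R y \<in> E" using pE y sub by (simp add: subspace_add subspace_scale)
    then have "(norm (x - p))\<^sup>2 \<le> (norm (x - (p + c *\<^sub>R y)))\<^sup>2"
      by (rule order_trans[OF \<open>(norm (x - p))\<^sup>2 \<le> d\<close> dle])
    also have "x - (p + c *\<^sub>R y) = (x - p) - c *\<^sub>R y" by simp
    also have "(norm ((x - p) - c *\<^sub>R y))\<^sup>2 = (norm (x - p))\<^sup>2 - 2 * c * ((x - p) \<bullet> y) + c * c * (y \<bullet> y)"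
      unfolding power2_norm_eq_inner inner_diff_left inner_diff_right
      by (simp add: inner_commute algebra_simps)
    also have "\<dots> = (norm (x - p))\<^sup>2 - ((x - p) \<bullet> y)\<^sup>2 / (y \<bullet> y)"
      using yy unfolding c_def by (simp add: field_simps power2_eq_square)
    finally have "((x - p) \<bullet> y)\<^sup>2 / (y \<bullet> y) \<le> 0" by simp
    then show ?thesis using yy by (simp add: divide_le_0_iff not_less)
  qed simp
  show ?thesis using that[OF pE orth] .
qed

lemma subspace_closure:
  fixes X :: "'h::real_normed_vector set"
  assumes "subspace X"
  shows "subspace (closure X)"
  unfolding subspace_def
proof (intro conjI ballI allI)
  show "0 \<in> closure X" using subspace_0[OF assms] closure_subset by blast
  fix x assume "x \<in> closure X"
  then obtain f where f: "\<And>n. f n \<in> X" "f \<longlonglongrightarrow> x" by (auto simp: closure_sequential)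
  show "c *\<^sub>R x \<in> closure X" for c
    unfolding closure_sequential
    by (intro exI[of _ "\<lambda>n. c *\<^sub>R f n"] conjI allI tendsto_intros f subspace_scale assms)
  fix y assume "y \<in> closure X"
  then obtain g where g: "\<And>n. g n \<in> X" "g \<longlonglongrightarrow> y" by (auto simp: closure_sequential)
  show "x + y \<in> closure X"
    unfolding closure_sequential
    by (intro exI[of _ "\<lambda>n. f n + g n"] conjI allI tendsto_intros f g subspace_add assms)
qed

lemma closure_subspace_eq_UNIV:
  fixes X :: "'h::{real_inner,complete_space} set"
  assumes "subspace X" and "\<And>x. (\<And>y. y \<in> X \<Longrightarrow> x \<bullet> y = 0) \<Longrightarrow> x = 0"
  shows "closure X = UNIV"
proof (intro equalityI subsetI UNIV_I)
  fix x
  obtain p where p: "p \<in> closure X" "\<And>y. y \<in> closure X \<Longrightarrow> (x - p) \<bullet> y = 0"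
    using closest_point_orthogonal[OF subspace_closure[OF assms(1)] closed_closure, of x] by blast
  have "x - p = 0"
    by (rule assms(2)) (use p closure_subset in blast)
  then show "x \<in> closure X" using p by simp
qed

text \<open>The kernel of a nonzero functional has codimension one, so a nonzero vector
  \<open>e\<close> orthogonal to it spans the complement, and a multiple of \<open>e\<close>
  represents \<open>f\<close>.\<close>

lemma riesz_representation:
  fixes f :: "'h::{real_inner,complete_space} \<Rightarrow> real"
  assumes f: "bounded_linear f"
  obtains z where "\<And>x. f x = x \<bullet> z"
proof (cases "\<forall>x. f x = 0")
  case True
  then show ?thesis using that[of 0] by simp
next
  case False
  then obtain x where x: "f x \<noteq> 0" by auto
  interpret f: bounded_linear f by fact
  let ?E = "{y. f y = 0}"
  have "subspace ?E" by (auto simp: subspace_def f.add f.scaleR f.zero)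
  moreover have "closed ?E"
    by (intro closed_Collect_eq linear_continuous_on f continuous_intros)
  ultimately obtain p where p: "f p = 0" "\<And>y. f y = 0 \<Longrightarrow> (x - p) \<bullet> y = 0"
    using closest_point_orthogonal[of ?E x] by auto
  define e where "e = x - p"
  have fe: "f e \<noteq> 0" using x p unfolding e_def by (simp add: f.diff)
  then have ee: "e \<bullet> e \<noteq> 0" by (auto simp: f.zero)
  have "f y = y \<bullet> ((f e / (e \<bullet> e)) *\<^sub>R e)" for y
  proof -
    have "f (y - (f y / f e) *\<^sub>R e) = 0" using fe by (simp add: f.diff f.scaleR)
    then have "e \<bullet> (y - (f y / f e) *\<^sub>R e) = 0" unfolding e_def by (rule p(2))
    then have "e \<bullet> y = f y / f e * (e \<bullet> e)" by (simp add: inner_diff_right)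
    then show ?thesis using fe ee by (simp add: inner_commute)
  qed
  then show ?thesis using that by blast
qed

text \<open>\<open>adjoint\<close> chooses some function with this property, so the equation is
  available only once existence is known; completeness of the domain supplies it through the Riesz
  representation.\<close>

lemma blinfun_adjoint_inner:
  fixes B :: "'a::{real_inner,complete_space} \<Rightarrow>\<^sub>L 'b::real_inner"
  shows "blinfun_apply B x \<bullet> y = x \<bullet> adjoint (blinfun_apply B) y"
proof -
  have "\<forall>y. \<exists>z. \<forall>x. blinfun_apply B x \<bullet> y = x \<bullet> z"
  proof
    fix y
    have "bounded_linear (\<lambda>x. blinfun_apply B x \<bullet> y)"
      by (intro bounded_linear_inner_left_comp blinfun.bounded_linear_right)
    then show "\<exists>z. \<forall>x. blinfun_apply B x \<bullet> y = x \<bullet> z"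
      using riesz_representation by metis
  qed
  then have "\<exists>g. \<forall>x y. blinfun_apply B x \<bullet> y = x \<bullet> g y" by metis
  then have "\<forall>x y. blinfun_apply B x \<bullet> y = x \<bullet> adjoint (blinfun_apply B) y"
    unfolding adjoint_def by (rule someI_ex)
  then show ?thesis by blast
qed

lemma blinfun_adjoint_diff:
  fixes B :: "'a::{real_inner,complete_space} \<Rightarrow>\<^sub>L 'b::real_inner"
  shows "adjoint (blinfun_apply B) (x - y) = adjoint (blinfun_apply B) x - adjoint (blinfun_apply B) y"
  by (simp add: vector_eq_ldot[symmetric] inner_diff_right blinfun_adjoint_inner[symmetric])

lemma blinfun_adjoint_diff_left:
  fixes B B' :: "'a::{real_inner,complete_space} \<Rightarrow>\<^sub>L 'b::real_inner"
  shows "adjoint (blinfun_apply (B - B')) y = adjoint (blinfun_apply B) y - adjoint (blinfun_apply B') y"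
  by (simp add: vector_eq_ldot[symmetric] inner_diff_right inner_diff_left blinfun.diff_left
      blinfun_adjoint_inner[symmetric])

lemma norm_blinfun_adjoint_le:
  fixes B :: "'a::{real_inner,complete_space} \<Rightarrow>\<^sub>L 'b::real_inner"
  shows "norm (adjoint (blinfun_apply B) y) \<le> norm B * norm y"
proof (cases "adjoint (blinfun_apply B) y = 0")
  case False
  let ?z = "adjoint (blinfun_apply B) y"
  have "norm ?z * norm ?z = blinfun_apply B ?z \<bullet> y"
    by (metis blinfun_adjoint_inner power2_eq_square power2_norm_eq_inner)
  also have "\<dots> \<le> norm (blinfun_apply B ?z) * norm y" by (rule norm_cauchy_schwarz)
  also have "\<dots> \<le> (norm B * norm ?z) * norm y" by (intro mult_right_mono norm_blinfun) auto
  finally have "norm ?z * norm ?z \<le> norm ?z * (norm B * norm y)" by (simp add: mult_ac)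
  then show ?thesis using False by simp
qed (simp add: mult_nonneg_nonneg)

text \<open>Joint continuity is the form required, since operator and velocity vary together in the
  damping and delay terms.\<close>

lemma tendsto_blinfun_adjoint:
  fixes B :: "'c \<Rightarrow> 'a::{real_inner,complete_space} \<Rightarrow>\<^sub>L 'b::real_inner"
  assumes B: "(B \<longlongrightarrow> B0) F" and y: "(y \<longlongrightarrow> y0) F"
  shows "((\<lambda>t. adjoint (blinfun_apply (B t)) (y t)) \<longlongrightarrow> adjoint (blinfun_apply B0) y0) F"
proof (subst Lim_null)
  have lim0: "((\<lambda>t. norm (B t) * norm (y t - y0) + norm (B t - B0) * norm y0) \<longlongrightarrow>
        norm B0 * norm (y0 - y0) + norm (B0 - B0) * norm y0) F"
    by (intro tendsto_intros B y)
  show "((\<lambda>t. adjoint (blinfun_apply (B t)) (y t) - adjoint (blinfun_apply B0) y0) \<longlongrightarrow> 0) F"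
  proof (rule Lim_null_comparison)
    show "((\<lambda>t. norm (B t) * norm (y t - y0) + norm (B t - B0) * norm y0) \<longlongrightarrow> 0) F"
      using lim0 by simp
    show "\<forall>\<^sub>F t in F. norm (adjoint (blinfun_apply (B t)) (y t) - adjoint (blinfun_apply B0) y0)
        \<le> norm (B t) * norm (y t - y0) + norm (B t - B0) * norm y0"
    proof (intro always_eventually allI)
      fix t
      have "adjoint (blinfun_apply (B t)) (y t) - adjoint (blinfun_apply B0) y0 =
          adjoint (blinfun_apply (B t)) (y t - y0) + adjoint (blinfun_apply (B t - B0)) y0"
        by (simp add: blinfun_adjoint_diff blinfun_adjoint_diff_left)
      then have "norm (adjoint (blinfun_apply (B t)) (y t) - adjoint (blinfun_apply B0) y0)
          \<le> norm (B t) * norm (y t - y0) + norm (B t - B0) * norm y0"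
        by (metis add_mono norm_blinfun_adjoint_le norm_triangle_le)
      then show "norm (adjoint (blinfun_apply (B t)) (y t) - adjoint (blinfun_apply B0) y0)
          \<le> norm (B t) * norm (y t - y0) + norm (B t - B0) * norm y0"
        by (simp add: norm_minus_commute)
    qed
  qed
qed

lemma continuous_on_blinfun_adjoint:
  fixes B :: "'c::topological_space \<Rightarrow> 'a::{real_inner,complete_space} \<Rightarrow>\<^sub>L 'b::real_inner"
  assumes "continuous_on X B" "continuous_on X y"
  shows "continuous_on X (\<lambda>t. adjoint (blinfun_apply (B t)) (y t))"
  using assms unfolding continuous_on_def by (auto intro: tendsto_blinfun_adjoint)

section \<open>The square root of an operator with compact inverse\<close>

text \<open>\<open>S\<close> stands for A^(1/2) and \<open>R\<close> for its inverse. Compactness is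
  asked of the square of \<open>R\<close>, which is A^(-1), so the hypothesis on A applies directly,
  without passing compactness to a square root.\<close>

locale compact_resolvent =
  fixes V :: "'h::{real_inner,complete_space} set" and S R :: "'h \<Rightarrow> 'h"
  assumes subspace_V: "subspace V"
    and S_add: "\<And>x y. x \<in> V \<Longrightarrow> y \<in> V \<Longrightarrow> S (x + y) = S x + S y"
    and S_scale: "\<And>x c. x \<in> V \<Longrightarrow> S (c *\<^sub>R x) = c *\<^sub>R S x"
    and S_sym: "\<And>x y. x \<in> V \<Longrightarrow> y \<in> V \<Longrightarrow> S x \<bullet> y = x \<bullet> S y"
    and R_in: "\<And>x. R x \<in> V" and S_R: "\<And>x. S (R x) = x" and R_S: "\<And>v. v \<in> V \<Longrightarrow> R (S v) = v"
    and R_bl: "bounded_linear R"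
    and RR_compact: "compact (closure ((\<lambda>x. R (R x)) ` cball 0 1))"
begin

lemma R_sym: "R x \<bullet> y = x \<bullet> R y"
  by (metis R_in S_R S_sym)

lemma R_eq_0_iff: "R x = 0 \<longleftrightarrow> x = 0"
  by (metis R_S S_R linear_simps(3)[OF R_bl] subspace_0[OF subspace_V])

lemma S_diff: "x \<in> V \<Longrightarrow> y \<in> V \<Longrightarrow> S (x - y) = S x - S y"
  using S_add[of x "(-1) *\<^sub>R y"] S_scale[of y "-1"] subspace_V by (simp add: subspace_neg)

lemma norm_le_norm_S: obtains k where "k > 0" "\<And>v. v \<in> V \<Longrightarrow> norm v \<le> k * norm (S v)"
proof -
  obtain k where "k > 0" "\<And>x. norm (R x) \<le> norm x * k"
    using bounded_linear.pos_bounded[OF R_bl] by blast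
  then show ?thesis using that[of k] by (metis R_S mult.commute)
qed

text \<open>On the unit sphere of the invariant subspace \<open>E\<close>, norm (R x)^2 is the
  Rayleigh quotient of R^2. Compactness of R^2 turns a maximising sequence into an
  eigenvector.\<close>

lemma eigenvector_exists:
  assumes E: "subspace E" "closed E" "\<And>x. x \<in> E \<Longrightarrow> R x \<in> E" and x0: "x0 \<in> E" "x0 \<noteq> 0"
  obtains e \<mu> where "e \<in> E" "e \<noteq> 0" "R (R e) = \<mu> *\<^sub>R e"
proof -
  interpret R: bounded_linear R by (rule R_bl)
  obtain k where k: "\<And>x. norm (R x) \<le> norm x * k"
    using bounded_linear.bounded[OF R_bl] by blast
  let ?Q = "(\<lambda>x. (norm (R x))\<^sup>2) ` {x \<in> E. norm x = 1}"
  define \<mu> where "\<mu> = Sup ?Q"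
  have bdd: "bdd_above ?Q"
  proof (rule bdd_aboveI2)
    fix x assume "x \<in> {x \<in> E. norm x = 1}"
    then show "(norm (R x))\<^sup>2 \<le> k\<^sup>2" using k[of x] by (simp add: power_mono)
  qed
  have unit: "(1 / norm x) *\<^sub>R x \<in> {x \<in> E. norm x = 1}" if "x \<in> E" "x \<noteq> 0" for x
    using that E(1) by (simp add: subspace_scale)
  have le: "(norm (R x))\<^sup>2 \<le> \<mu> * (norm x)\<^sup>2" if "x \<in> E" for x
  proof (cases "x = 0")
    case False
    have "(norm (R ((1 / norm x) *\<^sub>R x)))\<^sup>2 \<le> \<mu>"
      unfolding \<mu>_def by (rule cSup_upper[OF imageI[OF unit[OF that False]] bdd])
    moreover have "(norm (R ((1 / norm x) *\<^sub>R x)))\<^sup>2 = (norm (R x))\<^sup>2 / (norm x)\<^sup>2"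
      by (simp add: R.scaleR power_divide)
    ultimately show ?thesis using False by (simp add: divide_simps)
  qed (simp add: R.zero)
  have "0 < \<mu> * (norm x0)\<^sup>2" using le[OF x0(1)] x0(2)
    by (metis R_eq_0_iff less_le_trans zero_less_norm_iff zero_less_power)
  then have mu: "\<mu> > 0" using x0 by (simp add: zero_less_mult_iff)
  have ne: "?Q \<noteq> {}" using unit[OF x0] by blast
  have "\<exists>x\<in>E. norm x = 1 \<and> \<mu> - 1 / real (Suc n) < (norm (R x))\<^sup>2" for n
  proof -
    have "\<mu> - 1 / real (Suc n) < Sup ?Q" unfolding \<mu>_def by simp
    then show ?thesis using less_cSup_iff[OF ne bdd] by auto
  qed
  then obtain f where fE: "\<And>n. f n \<in> E" and f1: "\<And>n. norm (f n) = 1"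
    and fl: "\<And>n. \<mu> - 1 / real (Suc n) < (norm (R (f n)))\<^sup>2" by metis
  have "\<forall>n. R (R (f n)) \<in> closure ((\<lambda>x. R (R x)) ` cball 0 1)"
    by (intro allI subsetD[OF closure_subset] imageI) (simp add: f1)
  then obtain y r where r: "strict_mono r" "((\<lambda>n. R (R (f n))) \<circ> r) \<longlonglongrightarrow> y"
    using RR_compact unfolding compact_def by meson
  \<comment> \<open>Expanding the square and using norm (R (R f)) <= \<mu> leaves 2 \<mu> times the
    gap between \<mu> and norm (R f)^2: the maximising sequence consists of approximate
    eigenvectors.\<close>
  have small: "(norm (R (R (f n)) - \<mu> *\<^sub>R f n))\<^sup>2 \<le> 2 * \<mu> * (1 / real (Suc n))" for n
  proof -
    have a: "(norm (R (R (f n))))\<^sup>2 \<le> \<mu> * (\<mu> * 1)"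
      using order_trans[OF le[OF E(3)[OF fE[of n]]] mult_left_mono[OF le[OF fE[of n]]]] mu f1[of n]
      by simp
    have "(norm (R (R (f n)) - \<mu> *\<^sub>R f n))\<^sup>2
        = (norm (R (R (f n))))\<^sup>2 - 2 * \<mu> * (R (R (f n)) \<bullet> f n) + \<mu> * \<mu> * (f n \<bullet> f n)"
      unfolding power2_norm_eq_inner by (simp add: inner_diff_left inner_diff_right inner_commute algebra_simps)
    also have "R (R (f n)) \<bullet> f n = (norm (R (f n)))\<^sup>2" by (simp add: R_sym power2_norm_eq_inner)
    also have "f n \<bullet> f n = 1" by (simp add: f1 power2_norm_eq_inner[symmetric])
    also have "(norm (R (R (f n))))\<^sup>2 - 2 * \<mu> * (norm (R (f n)))\<^sup>2 + \<mu> * \<mu> * 1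
        \<le> 2 * \<mu> * (\<mu> - (norm (R (f n)))\<^sup>2)" using a by (simp add: algebra_simps)
    also have "\<dots> \<le> 2 * \<mu> * (1 / real (Suc n))"
      using fl[of n] mu by (intro mult_left_mono) auto
    finally show ?thesis .
  qed
  have lim2: "(\<lambda>n. 2 * \<mu> * (1 / real (Suc n))) \<longlonglongrightarrow> 0"
    using tendsto_mult_right_zero[OF LIMSEQ_inverse_real_of_nat, of "2 * \<mu>"] by (simp add: inverse_eq_divide)
  have "(\<lambda>n. (norm (R (R (f n)) - \<mu> *\<^sub>R f n))\<^sup>2) \<longlonglongrightarrow> 0"
    by (rule tendsto_sandwich[OF _ _ tendsto_const lim2]) (use small in auto)
  then have "(\<lambda>n. sqrt ((norm (R (R (f n)) - \<mu> *\<^sub>R f n))\<^sup>2)) \<longlonglongrightarrow> sqrt 0" by (rule tendsto_real_sqrt)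
  then have "(\<lambda>n. R (R (f n)) - \<mu> *\<^sub>R f n) \<longlonglongrightarrow> 0" by (simp add: tendsto_norm_zero_iff)
  then have "(\<lambda>n. R (R (f (r n))) - \<mu> *\<^sub>R f (r n)) \<longlonglongrightarrow> 0"
    using LIMSEQ_subseq_LIMSEQ[OF _ r(1)] by (force simp: o_def)
  \<comment> \<open>As \<mu> is positive, \<open>f\<close> is recovered from two convergent
    sequences, so the subsequence of \<open>f\<close> itself converges.\<close>
  then have "(\<lambda>n. (1 / \<mu>) *\<^sub>R (R (R (f (r n))) - (R (R (f (r n))) - \<mu> *\<^sub>R f (r n)))) \<longlonglongrightarrow> (1 / \<mu>) *\<^sub>R (y - 0)"
    using r(2) by (intro tendsto_intros) (auto simp: o_def)
  then have lim: "(\<lambda>n. f (r n)) \<longlonglongrightarrow> (1 / \<mu>) *\<^sub>R y" using mu by simp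
  let ?e = "(1 / \<mu>) *\<^sub>R y"
  have "?e \<in> E" by (rule closed_sequentially[OF E(2) _ lim]) (rule fE)
  moreover have "norm ?e = 1"
    using tendsto_norm[OF lim] unfolding f1 by (simp only: LIMSEQ_const_iff)
  then have "?e \<noteq> 0" by (metis norm_zero zero_neq_one)
  moreover have "R (R ?e) = \<mu> *\<^sub>R ?e"
  proof -
    have l1: "(\<lambda>n. R (R (f (r n)))) \<longlonglongrightarrow> R (R ?e)" by (intro R.tendsto lim)
    have l2: "(\<lambda>n. R (R (f (r n)))) \<longlonglongrightarrow> y" using r(2) by (simp add: o_def)
    show ?thesis using LIMSEQ_unique[OF l1 l2] mu by simp
  qed
  ultimately show ?thesis using that by blast
qed

definition eigen_span :: "'h set" where
  "eigen_span = span {e. \<exists>\<mu>. R (R e) = \<mu> *\<^sub>R e}"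

text \<open>\<open>R\<close> commutes with its square, hence preserves each eigenspace of
  R^2.\<close>

lemma R_eigen_span: "x \<in> eigen_span \<Longrightarrow> R x \<in> eigen_span"
  unfolding eigen_span_def
proof (induction rule: span_induct_alt)
  case base
  then show ?case by (simp add: linear_simps[OF R_bl] span_zero)
next
  case (step c x y)
  then obtain \<mu> where "R (R x) = \<mu> *\<^sub>R x" by auto
  then have "R (R (R x)) = \<mu> *\<^sub>R R x" by (simp add: linear_simps(5)[OF R_bl])
  then have "R x \<in> span {e. \<exists>\<mu>. R (R e) = \<mu> *\<^sub>R e}" by (intro span_base) auto
  then show ?case using step by (simp add: linear_simps[OF R_bl] span_add span_scale)
qed

text \<open>The orthogonal complement is closed and, \<open>R\<close> being symmetric, invariant. If
  it were nonzero it would contain an eigenvector, which would be orthogonal to itself.\<close>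

lemma closure_eigen_span: "closure eigen_span = UNIV"
proof (rule closure_subspace_eq_UNIV)
  show "subspace eigen_span" by (simp add: eigen_span_def subspace_span)
  let ?E = "{x. \<forall>y\<in>eigen_span. x \<bullet> y = 0}"
  fix x assume x: "\<And>y. y \<in> eigen_span \<Longrightarrow> x \<bullet> y = 0"
  show "x = 0"
  proof (rule ccontr)
    assume "x \<noteq> 0"
    have "subspace ?E" by (auto simp: subspace_def inner_add_left)
    moreover have "?E = (\<Inter>y\<in>eigen_span. {x. x \<bullet> y = 0})" by auto
    then have "closed ?E"
      by (simp only:) (intro closed_INT ballI closed_Collect_eq continuous_intros)
    moreover have "R z \<in> ?E" if "z \<in> ?E" for z
      using that by (simp add: R_sym R_eigen_span)
    ultimately obtain e \<mu> where e: "e \<in> ?E" "e \<noteq> 0" "R (R e) = \<mu> *\<^sub>R e"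
      using eigenvector_exists[of ?E x] x \<open>x \<noteq> 0\<close> by blast
    then have "e \<in> eigen_span" unfolding eigen_span_def by (intro span_base) auto
    then have "e \<bullet> e = 0" using e(1) by blast
    then show False using e(2) by simp
  qed
qed

text \<open>Density in the norm of V reduces to density in H: \<open>y\<close> close to
  \<open>S v\<close> gives \<open>R y\<close>, for which
  \<open>S (R y - v) = y - S v\<close>.\<close>

lemma eigen_span_approx:
  assumes "v \<in> V" "\<delta> > 0"
  obtains x where "x \<in> eigen_span" "x \<in> V" "norm (S (x - v)) < \<delta>"
proof -
  obtain y where y: "y \<in> eigen_span" "norm (y - S v) < \<delta>"
    using closure_eigen_span assms(2) closure_approachable[of "S v" eigen_span]
    by (auto simp: dist_norm)
  have "S (R y - v) = y - S v" using S_diff[OF R_in assms(1)] by (simp add: S_R)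
  then show ?thesis using that[of "R y"] R_eigen_span[OF y(1)] R_in y(2) by simp
qed

end

text \<open>A^(-1/2) is written as A^(1/2) A^(-1). Its square is A^(-1), so the compactness
  assumption carries over as it stands.\<close>

lemma compact_resolvent_sqrt:
  fixes D V :: "'h::{real_inner,complete_space} set"
  assumes A: "self_adjoint_op D A" "has_compact_inverse D A"
    and S: "is_positive_sqrt_op V S D A"
  shows "compact_resolvent V S (\<lambda>x. S (inv_into D A x))"
proof -
  have bij: "bij_betw A D UNIV" and comp: "compact (closure (inv_into D A ` cball 0 1))"
    using A(2) by (auto simp: has_compact_inverse_def)
  let ?K = "inv_into D A"
  let ?R = "\<lambda>x. S (?K x)"
  have KD: "?K x \<in> D" and AK: "A (?K x) = x" for x
    using bij by (auto simp: bij_betw_def inv_into_into f_inv_into_f)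
  have KA: "?K (A x) = x" if "x \<in> D" for x using bij that by (simp add: bij_betw_def)
  have lA: "linear_operator_on D A" using A(1) by (simp add: self_adjoint_op_def)
  have sS: "self_adjoint_op V S" and pS: "positive_op V S" and D: "D = {x \<in> V. S x \<in> V}"
    and AS: "\<And>x. x \<in> D \<Longrightarrow> A x = S (S x)" using S by (auto simp: is_positive_sqrt_op_def)
  have lS: "linear_operator_on V S" using sS by (simp add: self_adjoint_op_def)
  have subV: "subspace V" and Sadd: "\<And>x y. x \<in> V \<Longrightarrow> y \<in> V \<Longrightarrow> S (x + y) = S x + S y"
    and Ssc: "\<And>x c. x \<in> V \<Longrightarrow> S (c *\<^sub>R x) = c *\<^sub>R S x"
    using lS by (auto simp: linear_operator_on_def)
  have Ssym: "S x \<bullet> y = x \<bullet> S y" if "x \<in> V" "y \<in> V" for x y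
    using sS that unfolding self_adjoint_op_def by blast
  have subD: "subspace D" using lA by (simp add: linear_operator_on_def)
  have Kadd: "?K (x + y) = ?K x + ?K y" for x y
    using lA KD AK KA subD unfolding linear_operator_on_def by (metis subspace_add)
  have Ksc: "?K (c *\<^sub>R x) = c *\<^sub>R ?K x" for c x
    using lA KD AK KA subD unfolding linear_operator_on_def by (metis subspace_scale)
  have RV: "?R x \<in> V" and KV: "?K x \<in> V" for x using KD[of x] D by auto
  have SR: "S (?R x) = x" for x using AS[OF KD[of x]] AK[of x] by simp
  have Radd: "?R (x + y) = ?R x + ?R y" for x y using Kadd Sadd KV by simp
  have Rsc: "?R (c *\<^sub>R x) = c *\<^sub>R ?R x" for c x using Ksc Ssc KV by simp
  have Sinj: "x = 0" if "x \<in> V" "S x = 0" for x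
    using pS that unfolding positive_op_def by fastforce
  have RS: "?R (S v) = v" if "v \<in> V" for v
  proof -
    have m: "- v \<in> V" using that subV by (simp add: subspace_neg)
    have "S (?R (S v) + (- v)) = S (?R (S v)) + S (- v)" by (rule Sadd[OF RV m])
    also have "\<dots> = 0" using Ssc[OF that, of "-1"] SR by simp
    finally have "?R (S v) + (- v) = 0" using Sinj subspace_add[OF subV RV m] by blast
    then show ?thesis by simp
  qed
  \<comment> \<open>The image of the unit ball under A^(-1) is relatively compact, hence bounded;
    this yields the operator bound \<open>b\<close>.\<close>
  have "bounded (?K ` cball 0 1)"
    using compact_imp_bounded[OF comp] bounded_subset closure_subset by blast
  then obtain b where "\<forall>y\<in>?K ` cball 0 1. norm y \<le> b" unfolding bounded_iff by blast
  then have b: "norm (?K x) \<le> b" if "norm x \<le> 1" for x using that by simp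
  have Kb: "norm (?K x) \<le> b * norm x" for x
  proof (cases "x = 0")
    case True
    then show ?thesis using Ksc[of 0 0] by simp
  next
    case False
    have "norm (?K ((1 / norm x) *\<^sub>R x)) \<le> b" using False by (intro b) simp
    then show ?thesis using False unfolding Ksc by (simp add: divide_simps)
  qed
  have "b \<ge> 0" using order_trans[OF norm_ge_zero b[of 0]] by simp
  have "norm (?R x) \<le> norm x * sqrt b" for x
  proof -
    \<comment> \<open>Symmetry of \<open>S\<close> identifies the squared norm with the inner
      product of x and A^(-1) x, which explains the bound sqrt b.\<close>
    have "(norm (?R x))\<^sup>2 = ?R x \<bullet> S (?K x)" by (simp add: power2_norm_eq_inner)
    also have "\<dots> = S (?R x) \<bullet> ?K x" by (rule Ssym[symmetric, OF RV KV])
    also have "\<dots> \<le> norm x * norm (?K x)" unfolding SR by (rule norm_cauchy_schwarz)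
    also have "\<dots> \<le> norm x * (b * norm x)" by (intro mult_left_mono Kb) simp
    also have "\<dots> = (norm x * sqrt b)\<^sup>2" using \<open>b \<ge> 0\<close> by (simp add: power2_eq_square)
    finally show ?thesis by (rule power2_le_imp_le) (use \<open>b \<ge> 0\<close> in simp)
  qed
  then have Rbl: "bounded_linear ?R" by (intro bounded_linear_intro[of _ "sqrt b"] Radd Rsc)
  have RR: "?R (?R x) = ?K x" for x using RS[OF KV[of x]] .
  show ?thesis
    by (rule compact_resolvent.intro) (use subV Sadd Ssc Ssym RV SR RS Rbl comp in \<open>simp_all add: RR\<close>)
qed

section \<open>Free waves\<close>

lemma has_dual_derivative_cong_ev:
  assumes "has_dual_derivative V S f F t" "\<forall>\<^sub>F s in at t. f s = g s" "f t = g t"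
    "\<And>v. v \<in> V \<Longrightarrow> F v = G v"
  shows "has_dual_derivative V S g G t"
  unfolding has_dual_derivative_def
proof (intro allI impI)
  fix e :: real assume "e > 0"
  then have "\<forall>\<^sub>F s in at t. \<forall>v\<in>V. \<bar>inner ((1 / (s - t)) *\<^sub>R (f s - f t)) v - F v\<bar> \<le> e * norm (S v)"
    using assms(1) by (simp add: has_dual_derivative_def)
  then show "\<forall>\<^sub>F s in at t. \<forall>v\<in>V. \<bar>inner ((1 / (s - t)) *\<^sub>R (g s - g t)) v - G v\<bar> \<le> e * norm (S v)"
    using assms(2) by eventually_elim (use assms(3,4) in simp)
qed

lemma has_dual_derivative_diff:
  assumes "has_dual_derivative V S f F t" "has_dual_derivative V S g G t"
  shows "has_dual_derivative V S (\<lambda>s. f s - g s) (\<lambda>v. F v - G v) t"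
  unfolding has_dual_derivative_def
proof (intro allI impI)
  fix e :: real assume "e > 0"
  then have "e / 2 > 0" by simp
  then have "\<forall>\<^sub>F s in at t. \<forall>v\<in>V. \<bar>inner ((1 / (s - t)) *\<^sub>R (f s - f t)) v - F v\<bar> \<le> e / 2 * norm (S v)"
    "\<forall>\<^sub>F s in at t. \<forall>v\<in>V. \<bar>inner ((1 / (s - t)) *\<^sub>R (g s - g t)) v - G v\<bar> \<le> e / 2 * norm (S v)"
    using assms unfolding has_dual_derivative_def by blast+
  then show "\<forall>\<^sub>F s in at t. \<forall>v\<in>V.
      \<bar>inner ((1 / (s - t)) *\<^sub>R ((f s - g s) - (f t - g t))) v - (F v - G v)\<bar> \<le> e * norm (S v)"
  proof eventually_elim
    case (elim s)
    show ?case
    proof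
      fix v assume v: "v \<in> V"
      have "inner ((1 / (s - t)) *\<^sub>R ((f s - g s) - (f t - g t))) v
        = inner ((1 / (s - t)) *\<^sub>R (f s - f t)) v - inner ((1 / (s - t)) *\<^sub>R (g s - g t)) v"
        by (simp add: inner_diff_left scaleR_diff_right)
      moreover have "e / 2 * norm (S v) + e / 2 * norm (S v) = e * norm (S v)" by simp
      ultimately show "\<bar>inner ((1 / (s - t)) *\<^sub>R ((f s - g s) - (f t - g t))) v - (F v - G v)\<bar>
          \<le> e * norm (S v)"
        using elim(1)[rule_format, OF v] elim(2)[rule_format, OF v] by linarith
    qed
  qed
qed

lemma time_deriv_eq:
  assumes "t \<ge> 0" "(u has_vector_derivative z) (at t within {0..})"
  shows "time_deriv u t = z"
  unfolding time_deriv_def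
proof (rule vector_derivative_within[OF _ assms(2)])
  have "at t within {0..} \<noteq> bot \<longleftrightarrow> t islimpt {0..}" by (simp add: trivial_limit_within)
  moreover have "t islimpt {t..t+1}" by (simp add: islimpt_Icc)
  ultimately show "at t within {0..} \<noteq> bot"
    using islimpt_subset[of t "{t..t+1}" "{0..}"] assms(1) by auto
qed

lemma has_vector_derivative_shift:
  assumes "(f has_vector_derivative D) (at (t + c))"
  shows "((\<lambda>t. f (t + c)) has_vector_derivative D) (at t)"
proof -
  have "((\<lambda>t. t + c) has_vector_derivative 1) (at t)"
    by (auto intro!: derivative_eq_intros)
  from vector_diff_chain_at[OF this] assms show ?thesis by (simp add: o_def)
qed

text \<open>\<open>z\<close> is the velocity and \<open>g\<close> the force in u_tt + A u = g. The
  equation is asked only in the open interval, continuity on the closed one, because a piece may end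
  at a switching time, where the operators may jump.\<close>

definition weak_wave_on ::
  "'h::real_inner set \<Rightarrow> ('h \<Rightarrow> 'h) \<Rightarrow> real \<Rightarrow> real \<Rightarrow> (real \<Rightarrow> 'h) \<Rightarrow> (real \<Rightarrow> 'h) \<Rightarrow> (real \<Rightarrow> 'h) \<Rightarrow> bool"
  where "weak_wave_on V S a b u z g \<longleftrightarrow>
    (\<forall>t\<in>{a..b}. u t \<in> V) \<and> continuous_on {a..b} (\<lambda>t. S (u t)) \<and>
    continuous_on {a..b} z \<and> continuous_on {a..b} g \<and>
    (\<forall>t\<in>{a<..<b}. (u has_vector_derivative z t) (at t) \<and>
       has_dual_derivative V S z (\<lambda>v. - (S (u t) \<bullet> S v) + g t \<bullet> v) t)"

lemma weak_wave_on_subinterval: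
  assumes "weak_wave_on V S a b u z g" "a \<le> a'" "b' \<le> b"
  shows "weak_wave_on V S a' b' u z g"
  using assms unfolding weak_wave_on_def
  by (auto intro: continuous_on_subset[where s = "{a..b}"])

context compact_resolvent begin

text \<open>Convergence in H implies convergence in the dual of V because the norm of V dominates
  that of H.\<close>

lemma has_dual_derivative_strong:
  assumes "(z has_vector_derivative D) (at t)" "\<And>v. v \<in> V \<Longrightarrow> F v = D \<bullet> v"
  shows "has_dual_derivative V S z F t"
  unfolding has_dual_derivative_def
proof (intro allI impI)
  fix e :: real assume e: "e > 0"
  obtain k where k: "k > 0" "\<And>v. v \<in> V \<Longrightarrow> norm v \<le> k * norm (S v)" using norm_le_norm_S by blast
  have "((\<lambda>s. (z s - z t - (s - t) *\<^sub>R D) /\<^sub>R norm (s - t)) \<longlongrightarrow> 0) (at t)"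
    using assms(1) by (simp add: has_vector_derivative_def has_derivative_def)
  then have "\<forall>\<^sub>F s in at t. norm ((z s - z t - (s - t) *\<^sub>R D) /\<^sub>R norm (s - t)) < e / k"
    using e k(1) by (intro order_tendstoD(2)[OF tendsto_norm_zero]) auto
  moreover have "\<forall>\<^sub>F s in at t. s \<noteq> t" by (simp add: eventually_at_filter)
  ultimately show "\<forall>\<^sub>F s in at t. \<forall>v\<in>V.
      \<bar>inner ((1 / (s - t)) *\<^sub>R (z s - z t)) v - F v\<bar> \<le> e * norm (S v)"
  proof eventually_elim
    case (elim s)
    show ?case
    proof
      fix v assume v: "v \<in> V"
      let ?q = "(1 / (s - t)) *\<^sub>R (z s - z t) - D"
      have "?q = (1 / (s - t)) *\<^sub>R (z s - z t - (s - t) *\<^sub>R D)"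
        using elim(2) by (simp add: scaleR_diff_right)
      then have q: "norm ?q \<le> e / k" using elim(1) by (simp add: divide_inverse_commute)
      have "\<bar>?q \<bullet> v\<bar> \<le> norm ?q * norm v" by (rule Cauchy_Schwarz_ineq2)
      also have "\<dots> \<le> (e / k) * (k * norm (S v))"
        using e k(1) by (intro mult_mono q k(2) v) auto
      also have "\<dots> = e * norm (S v)" using k(1) by simp
      finally show "\<bar>inner ((1 / (s - t)) *\<^sub>R (z s - z t)) v - F v\<bar> \<le> e * norm (S v)"
        by (simp add: inner_diff_left assms(2)[OF v])
    qed
  qed
qed

text \<open>Strong solutions, with position in the domain of A. They live on the whole line, so
  every time translate is again one; continuity of \<open>S (w t)\<close> is listed separately
  because differentiability of \<open>w\<close> in H does not give it.\<close>

definition classical_wave :: "(real \<Rightarrow> 'h) \<Rightarrow> (real \<Rightarrow> 'h) \<Rightarrow> bool" where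
  "classical_wave w z \<longleftrightarrow> (\<forall>t. w t \<in> V \<and> S (w t) \<in> V \<and>
     (w has_vector_derivative z t) (at t) \<and> (z has_vector_derivative - S (S (w t))) (at t)) \<and>
     continuous_on UNIV (\<lambda>t. S (w t))"

lemma classical_wave_add:
  assumes "classical_wave w z" "classical_wave w' z'"
  shows "classical_wave (\<lambda>t. w t + w' t) (\<lambda>t. z t + z' t)"
proof -
  have 1: "S (w t + w' t) = S (w t) + S (w' t)" for t
    using assms by (simp add: classical_wave_def S_add)
  have 2: "S (S (w t) + S (w' t)) = S (S (w t)) + S (S (w' t))" for t
    using assms by (simp add: classical_wave_def S_add)
  have "((\<lambda>t. z t + z' t) has_vector_derivative - (S (S (w t)) + S (S (w' t)))) (at t)" for t
    using has_vector_derivative_add[of z "- S (S (w t))" "at t" z' "- S (S (w' t))"] assms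
    by (simp add: classical_wave_def algebra_simps)
  then show ?thesis using assms subspace_V unfolding classical_wave_def 1 2
    by (auto intro: subspace_add has_vector_derivative_add continuous_on_add)
qed

lemma classical_wave_shift:
  assumes "classical_wave w z"
  shows "classical_wave (\<lambda>t. w (t - a)) (\<lambda>t. z (t - a))"
proof -
  have sh: "((\<lambda>t. f (t - a)) has_vector_derivative D) (at t)"
    if "(f has_vector_derivative D) (at (t - a))" for f :: "real \<Rightarrow> 'h" and D t
    using has_vector_derivative_shift[of f D t "- a"] that by simp
  have "continuous_on UNIV ((\<lambda>t. S (w t)) \<circ> (\<lambda>t. t - a))"
    using assms unfolding classical_wave_def
    by (intro continuous_on_compose continuous_intros) (auto intro: continuous_on_subset)
  then show ?thesis using assms sh unfolding classical_wave_def o_def by blast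
qed

text \<open>On an eigenvector of A^(-1) with eigenvalue \<mu>, the operator A multiplies by
  \<omega>^2 = 1/\<mu>, and the wave equation becomes the harmonic oscillator for the coefficient.
  Positivity of \<mu> follows from \<mu> norm e^2 = norm (R e)^2.\<close>

lemma classical_wave_eigenvector:
  assumes e: "e \<noteq> 0" "R (R e) = \<mu> *\<^sub>R e"
  obtains \<omega> where "\<omega> > 0"
    "\<And>\<phi> \<psi>. (\<And>t. (\<phi> has_real_derivative \<psi> t) (at t)) \<Longrightarrow>
       (\<And>t. (\<psi> has_real_derivative - \<omega>\<^sup>2 * \<phi> t) (at t)) \<Longrightarrow>
       classical_wave (\<lambda>t. \<phi> t *\<^sub>R e) (\<lambda>t. \<psi> t *\<^sub>R e)"
proof -
  have "\<mu> * (e \<bullet> e) = R e \<bullet> R e" using e(2) by (metis R_sym inner_scaleR_left)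
  moreover have "R e \<bullet> R e > 0" "e \<bullet> e > 0" using e(1) R_eq_0_iff by auto
  ultimately have mu: "\<mu> > 0" by (metis zero_less_mult_pos2)
  define \<omega> where "\<omega> = 1 / sqrt \<mu>"
  have om: "\<omega> > 0" "\<omega>\<^sup>2 * \<mu> = 1" using mu by (auto simp: \<omega>_def power_divide)
  have "\<omega>\<^sup>2 *\<^sub>R R (R e) = e" using om e by simp
  then have eV: "e \<in> V" using R_in subspace_V by (metis subspace_scale)
  have Se: "S e = \<omega>\<^sup>2 *\<^sub>R R e"
    using S_scale[OF R_in, of "\<omega>\<^sup>2" "R e"] \<open>\<omega>\<^sup>2 *\<^sub>R R (R e) = e\<close> by (simp add: S_R)
  then have SeV: "S e \<in> V" and SSe: "S (S e) = \<omega>\<^sup>2 *\<^sub>R e"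
    using R_in subspace_V S_scale[OF R_in] by (auto simp: subspace_scale S_R)
  show ?thesis
  proof (rule that[OF om(1)])
    fix \<phi> \<psi> :: "real \<Rightarrow> real"
    assume d: "\<And>t. (\<phi> has_real_derivative \<psi> t) (at t)"
      "\<And>t. (\<psi> has_real_derivative - \<omega>\<^sup>2 * \<phi> t) (at t)"
    have c: "continuous_on UNIV \<phi>"
      using d(1) DERIV_isCont by (simp add: continuous_on_eq_continuous_at) blast
    have "((\<lambda>t. \<phi> t *\<^sub>R e) has_vector_derivative \<psi> t *\<^sub>R e) (at t)"
      "((\<lambda>t. \<psi> t *\<^sub>R e) has_vector_derivative (- \<omega>\<^sup>2 * \<phi> t) *\<^sub>R e) (at t)" for t
      using has_vector_derivative_scaleR[OF d(1)[of t] has_vector_derivative_const[of e "at t"]]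
        has_vector_derivative_scaleR[OF d(2)[of t] has_vector_derivative_const[of e "at t"]] by simp_all
    moreover have "continuous_on UNIV (\<lambda>t. \<phi> t *\<^sub>R S e)" by (intro continuous_intros c)
    ultimately show "classical_wave (\<lambda>t. \<phi> t *\<^sub>R e) (\<lambda>t. \<psi> t *\<^sub>R e)"
      using eV SeV subspace_V
      by (auto simp: classical_wave_def S_scale SSe subspace_scale mult.commute)
  qed
qed

lemma classical_wave_zero: "classical_wave (\<lambda>t. 0) (\<lambda>t. 0)"
  using subspace_0[OF subspace_V] S_scale[of 0 0] by (simp add: classical_wave_def)

text \<open>The oscillations cos (\<omega> t) and sin (\<omega> t) / \<omega> realise a prescribed
  position and a prescribed velocity on one eigenvector; superposition covers the span.\<close>

lemma classical_wave_data:
  assumes "x \<in> eigen_span"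
  shows "(\<exists>w z. classical_wave w z \<and> w 0 = x \<and> z 0 = 0) \<and>
         (\<exists>w z. classical_wave w z \<and> w 0 = 0 \<and> z 0 = x)"
  using assms unfolding eigen_span_def
proof (induction rule: span_induct_alt)
  case base
  then show ?case using classical_wave_zero by blast
next
  case (step c x y)
  have "(\<exists>w z. classical_wave w z \<and> w 0 = c *\<^sub>R x \<and> z 0 = 0) \<and>
      (\<exists>w z. classical_wave w z \<and> w 0 = 0 \<and> z 0 = c *\<^sub>R x)"
  proof (cases "x = 0")
    case True
    then show ?thesis using classical_wave_zero by auto
  next
    case False
    obtain \<mu> where "R (R x) = \<mu> *\<^sub>R x" using step by auto
    from classical_wave_eigenvector[OF False this]
    obtain \<omega> where om: "\<omega> > 0" and w: "\<And>\<phi> \<psi>. (\<And>t. (\<phi> has_real_derivative \<psi> t) (at t)) \<Longrightarrow>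
       (\<And>t. (\<psi> has_real_derivative - \<omega>\<^sup>2 * \<phi> t) (at t)) \<Longrightarrow>
       classical_wave (\<lambda>t. \<phi> t *\<^sub>R x) (\<lambda>t. \<psi> t *\<^sub>R x)" by blast
    have "classical_wave (\<lambda>t. (c * cos (\<omega> * t)) *\<^sub>R x) (\<lambda>t. (- c * \<omega> * sin (\<omega> * t)) *\<^sub>R x)"
      by (rule w) (auto intro!: derivative_eq_intros simp: power2_eq_square)
    moreover have "classical_wave (\<lambda>t. (c * sin (\<omega> * t) / \<omega>) *\<^sub>R x) (\<lambda>t. (c * cos (\<omega> * t)) *\<^sub>R x)"
      by (rule w) (use om in \<open>auto intro!: derivative_eq_intros simp: power2_eq_square\<close>)
    ultimately show ?thesis by fastforce
  qed
  then obtain w z w' z' where 1: "classical_wave w z" "w 0 = c *\<^sub>R x" "z 0 = 0"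
    "classical_wave w' z'" "w' 0 = 0" "z' 0 = c *\<^sub>R x" by blast
  obtain v y1 v' y' where 2: "classical_wave v y1" "v 0 = y" "y1 0 = 0"
    "classical_wave v' y'" "v' 0 = 0" "y' 0 = y" using step by blast
  show ?case
    by (intro conjI exI[of _ "\<lambda>t. w t + v t"] exI[of _ "\<lambda>t. z t + y1 t"]
        exI[of _ "\<lambda>t. w' t + v' t"] exI[of _ "\<lambda>t. z' t + y' t"] classical_wave_add 1 2)
      (simp_all add: 1 2)
qed

text \<open>A wave starting at rest is added to one starting from position 0. The position must be
  approximated in the norm of V, the velocity only in H.\<close>

lemma classical_wave_approx:
  assumes "v0 \<in> V" "\<delta> > 0"
  obtains w z where "classical_wave w z" "norm (S (w 0 - v0)) < \<delta>" "norm (z 0 - v1) < \<delta>"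
proof -
  obtain x where x: "x \<in> eigen_span" "norm (S (x - v0)) < \<delta>"
    using eigen_span_approx[OF assms] by blast
  obtain y where y: "y \<in> eigen_span" "norm (y - v1) < \<delta>"
    using closure_approachable[of v1 eigen_span] assms(2) unfolding closure_eigen_span dist_norm by auto
  obtain w z w' z' where "classical_wave w z" "w 0 = x" "z 0 = 0"
    "classical_wave w' z'" "w' 0 = 0" "z' 0 = y"
    using classical_wave_data[OF x(1)] classical_wave_data[OF y(1)] by metis
  then show ?thesis using that[OF classical_wave_add[of w z w' z']] x y by simp
qed

lemma classical_wave_dual_derivative:
  assumes "classical_wave w z"
  shows "has_dual_derivative V S z (\<lambda>v. - (S (w t) \<bullet> S v)) t"
  using assms by (intro has_dual_derivative_strong[of _ "- S (S (w t))"])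
    (auto simp: classical_wave_def S_sym)

lemma continuous_on_velocity:
  assumes "classical_wave w z" shows "continuous_on X z"
proof (intro continuous_at_imp_continuous_on ballI)
  fix t
  have "(z has_vector_derivative - S (S (w t))) (at t)" using assms by (simp add: classical_wave_def)
  then show "isCont z t" by (rule has_vector_derivative_continuous)
qed

lemma classical_wave_time_deriv:
  assumes "classical_wave w z" "t \<ge> 0"
  shows "time_deriv w t = z t"
proof (rule time_deriv_eq[OF assms(2)])
  have "(w has_vector_derivative z t) (at t)" using assms by (simp add: classical_wave_def)
  then show "(w has_vector_derivative z t) (at t within {0..})" by (rule has_vector_derivative_at_within)
qed

lemma free_wave_solution_classical:
  assumes w: "classical_wave w z"
  shows "free_wave_solution V S (w 0) (z 0) w"
proof -
  have cS: "continuous_on UNIV (\<lambda>t. S (w t))" and wV: "\<And>t. w t \<in> V"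
    and d: "\<And>t. (w has_vector_derivative z t) (at t)"
    using w by (auto simp: classical_wave_def)
  have "((\<lambda>s. norm (S (w s - w t))) \<longlongrightarrow> 0) (at t within {0..})" for t
  proof -
    have "((\<lambda>s. S (w s)) \<longlongrightarrow> S (w t)) (at t within {0..})"
      using cS by (meson UNIV_I continuous_on_def subset_UNIV tendsto_within_subset)
    then have "((\<lambda>s. norm (S (w s) - S (w t))) \<longlongrightarrow> 0) (at t within {0..})"
      by (simp add: tendsto_norm_zero_iff Lim_null[symmetric])
    then show ?thesis by (simp add: S_diff wV)
  qed
  moreover have "w differentiable (at t within {0..})" for t
    using d has_vector_derivative_at_within differentiableI_vector by blast
  moreover have "continuous_on {0..} (time_deriv w)"
    using continuous_on_velocity[OF w, of "{0..}"]
    by (rule continuous_on_eq) (simp add: classical_wave_time_deriv[OF w])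
  moreover have "has_dual_derivative V S (time_deriv w) (\<lambda>v. - inner (S (w t)) (S v)) t" if "t > 0" for t
  proof (rule has_dual_derivative_cong_ev[OF classical_wave_dual_derivative[OF w]])
    have "\<forall>\<^sub>F s in at t. s > 0"
      using order_tendstoD(1)[OF tendsto_ident_at that] .
    then show "\<forall>\<^sub>F s in at t. z s = time_deriv w s"
      by eventually_elim (simp add: classical_wave_time_deriv[OF w])
  qed (use that in \<open>simp_all add: classical_wave_time_deriv[OF w]\<close>)
  ultimately show ?thesis
    using wV by (simp add: free_wave_solution_def energy_class_def classical_wave_time_deriv[OF w])
qed

text \<open>Subtracting a free wave leaves the force unchanged, so with matching data the difference
  is driven by \<open>g\<close> alone.\<close>

lemma weak_wave_on_diff:
  assumes u: "weak_wave_on V S a b u z g" and w: "classical_wave w y"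
  shows "weak_wave_on V S a b (\<lambda>t. u t - w t) (\<lambda>t. z t - y t) g"
proof -
  have wV: "\<And>t. w t \<in> V" and cS: "continuous_on UNIV (\<lambda>t. S (w t))"
    and d: "\<And>t. (w has_vector_derivative y t) (at t)"
    using w by (auto simp: classical_wave_def)
  have uV: "\<And>t. t \<in> {a..b} \<Longrightarrow> u t \<in> V" using u by (simp add: weak_wave_on_def)
  have eq: "S (u t - w t) = S (u t) - S (w t)" if "t \<in> {a..b}" for t
    using S_diff uV[OF that] wV by blast
  have "continuous_on {a..b} (\<lambda>t. S (u t) - S (w t))"
    using u continuous_on_subset[OF cS]
    by (auto simp: weak_wave_on_def intro!: continuous_on_diff)
  then have "continuous_on {a..b} (\<lambda>t. S (u t - w t))"
    by (rule continuous_on_eq) (simp add: eq)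
  moreover have "has_dual_derivative V S (\<lambda>t. z t - y t)
      (\<lambda>v. - (S (u t - w t) \<bullet> S v) + g t \<bullet> v) t" if t: "t \<in> {a<..<b}" for t
  proof (rule has_dual_derivative_cong_ev)
    show "has_dual_derivative V S (\<lambda>t. z t - y t)
      (\<lambda>v. (- (S (u t) \<bullet> S v) + g t \<bullet> v) - (- (S (w t) \<bullet> S v))) t"
      using u t by (intro has_dual_derivative_diff classical_wave_dual_derivative w)
        (simp add: weak_wave_on_def)
  qed (use t in \<open>simp_all add: eq inner_diff_left\<close>)
  ultimately show ?thesis
    using u wV d subspace_V continuous_on_velocity[OF w] unfolding weak_wave_on_def
    by (auto intro!: subspace_diff continuous_on_diff has_vector_derivative_diff)
qed

end

section \<open>The energy identity\<close>

lemma has_vector_derivative_quotient: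
  assumes "(f has_vector_derivative D) (at t)"
  shows "((\<lambda>s. (1 / (s - t)) *\<^sub>R (f s - f t)) \<longlongrightarrow> D) (at t)"
proof (subst Lim_null, subst tendsto_norm_zero_iff[symmetric])
  have "((\<lambda>s. (f s - f t - (s - t) *\<^sub>R D) /\<^sub>R norm (s - t)) \<longlongrightarrow> 0) (at t)"
    using assms by (simp add: has_vector_derivative_def has_derivative_def)
  then have l: "((\<lambda>s. norm ((f s - f t - (s - t) *\<^sub>R D) /\<^sub>R norm (s - t))) \<longlongrightarrow> 0) (at t)"
    by (rule tendsto_norm_zero)
  have "norm ((f s - f t - (s - t) *\<^sub>R D) /\<^sub>R norm (s - t)) = norm ((1 / (s - t)) *\<^sub>R (f s - f t) - D)"
    if "s \<noteq> t" for s
  proof -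
    have "(1 / (s - t)) *\<^sub>R (f s - f t) - D = (1 / (s - t)) *\<^sub>R (f s - f t - (s - t) *\<^sub>R D)"
      using that by (simp add: scaleR_diff_right)
    then show ?thesis by (simp add: divide_inverse_commute)
  qed
  then have "\<forall>\<^sub>F s in at t. norm ((f s - f t - (s - t) *\<^sub>R D) /\<^sub>R norm (s - t))
      = norm ((1 / (s - t)) *\<^sub>R (f s - f t) - D)"
    by (auto simp: eventually_at_filter)
  then show "((\<lambda>s. norm ((1 / (s - t)) *\<^sub>R (f s - f t) - D)) \<longlongrightarrow> 0) (at t)"
    using l by (rule Lim_transform_eventually[rotated])
qed

text \<open>Product rule with one factor differentiable only in the dual of V. The test vector moves
  with \<open>s\<close>, so the difference quotients must converge uniformly on sets bounded in V;
  convergence in the dual norm provides this.\<close>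

lemma dual_derivative_inner:
  fixes v :: "real \<Rightarrow> 'h::real_inner"
  assumes z: "has_dual_derivative V S z (\<lambda>v. - (U \<bullet> S v) + g \<bullet> v) t"
    and v: "(v has_vector_derivative v') (at t)" "\<forall>\<^sub>F s in at t. v s \<in> V"
      "((\<lambda>s. S (v s)) \<longlongrightarrow> S (v t)) (at t)"
  shows "((\<lambda>s. z s \<bullet> v s) has_real_derivative - (U \<bullet> S (v t)) + g \<bullet> v t + z t \<bullet> v') (at t)"
proof -
  let ?F = "\<lambda>v. - (U \<bullet> S v) + g \<bullet> v"
  let ?q = "\<lambda>s. (1 / (s - t)) *\<^sub>R (z s - z t)"
  have 1: "((\<lambda>s. ?q s \<bullet> v s - ?F (v s)) \<longlongrightarrow> 0) (at t)"
  proof (rule tendstoI)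
    fix \<epsilon> :: real assume eps: "\<epsilon> > 0"
    define N where "N = norm (S (v t)) + 1"
    have N: "N > 0" unfolding N_def by (simp add: add_nonneg_pos)
    have "\<forall>\<^sub>F s in at t. norm (S (v s)) < N"
      by (rule order_tendstoD(2)[OF tendsto_norm[OF v(3)]]) (simp add: N_def)
    moreover have "\<forall>\<^sub>F s in at t. \<forall>x\<in>V. \<bar>?q s \<bullet> x - ?F x\<bar> \<le> \<epsilon> / (2 * N) * norm (S x)"
      by (rule z[unfolded has_dual_derivative_def, rule_format]) (use eps N in simp)
    ultimately show "\<forall>\<^sub>F s in at t. dist (?q s \<bullet> v s - ?F (v s)) 0 < \<epsilon>"
      using v(2)
    proof eventually_elim
      case (elim s)
      have "\<bar>?q s \<bullet> v s - ?F (v s)\<bar> \<le> \<epsilon> / (2 * N) * norm (S (v s))" using elim(2,3) by blast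
      also have "\<dots> \<le> \<epsilon> / (2 * N) * N" using elim(1) eps N by (intro mult_left_mono) auto
      also have "\<dots> < \<epsilon>" using eps N by simp
      finally show ?case by (simp add: dist_real_def)
    qed
  qed
  have "(v \<longlongrightarrow> v t) (at t)"
    using has_vector_derivative_continuous[OF v(1)] by (simp add: isCont_def)
  then have 2: "((\<lambda>s. ?F (v s)) \<longlongrightarrow> ?F (v t)) (at t)" by (intro tendsto_intros v(3))
  have 3: "((\<lambda>s. z t \<bullet> ((1 / (s - t)) *\<^sub>R (v s - v t))) \<longlongrightarrow> z t \<bullet> v') (at t)"
    by (intro tendsto_intros has_vector_derivative_quotient v(1))
  have "((\<lambda>s. ?q s \<bullet> v s - ?F (v s) + ?F (v s) + z t \<bullet> ((1 / (s - t)) *\<^sub>R (v s - v t)))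
      \<longlongrightarrow> 0 + ?F (v t) + z t \<bullet> v') (at t)"
    by (intro tendsto_add 1 2 3)
  moreover have "?q s \<bullet> v s - ?F (v s) + ?F (v s) + z t \<bullet> ((1 / (s - t)) *\<^sub>R (v s - v t))
      = (z s \<bullet> v s - z t \<bullet> v t) / (s - t)" for s
    by (simp add: inner_diff_left inner_diff_right add_divide_distrib[symmetric])
  ultimately show ?thesis by (simp add: has_field_derivative_iff)
qed

definition wave_energy :: "('h::real_inner \<Rightarrow> 'h) \<Rightarrow> (real \<Rightarrow> 'h) \<Rightarrow> (real \<Rightarrow> 'h) \<Rightarrow> real \<Rightarrow> real" where
  "wave_energy S u z t = 1 / 2 * ((norm (S (u t)))\<^sup>2 + (norm (z t))\<^sup>2)"

lemma wave_energy_nonneg: "wave_energy S u z t \<ge> 0"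
  by (simp add: wave_energy_def)

lemma norm_velocity_le_energy: "(norm (z t))\<^sup>2 \<le> 2 * wave_energy S u z t"
  by (simp add: wave_energy_def)

lemma continuous_on_wave_energy:
  assumes "weak_wave_on V S a b u z g"
  shows "continuous_on {a..b} (wave_energy S u z)"
  using assms unfolding weak_wave_on_def wave_energy_def[abs_def]
  by (intro continuous_intros) auto

context compact_resolvent begin

text \<open>The velocity is not an admissible test vector, so the equation is tested with the symmetric
  difference \<open>u (r + h) - u (r - h)\<close>: all terms without \<open>g\<close> then telescope, and
  division by \<open>2 h\<close> gives the identity as \<open>h\<close> tends to \<open>0\<close>.\<close>

lemma energy_identity_interior:
  assumes w: "weak_wave_on V S a b u z g" and st: "a < s" "s \<le> t" "t < b"
  shows "((\<lambda>r. g r \<bullet> z r) has_integral (wave_energy S u z t - wave_energy S u z s)) {s..t}"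
proof -
  have uV: "\<And>x. x \<in> {a..b} \<Longrightarrow> u x \<in> V"
    and cS: "continuous_on {a..b} (\<lambda>t. S (u t))" and cz: "continuous_on {a..b} z"
    and cg: "continuous_on {a..b} g"
    and ud: "\<And>x. x \<in> {a<..<b} \<Longrightarrow> (u has_vector_derivative z x) (at x)"
    and zd: "\<And>x. x \<in> {a<..<b} \<Longrightarrow> has_dual_derivative V S z (\<lambda>v. - (S (u x) \<bullet> S v) + g x \<bullet> v) x"
    using w by (auto simp: weak_wave_on_def)
  have isC: "isCont f x" if "continuous_on {a..b} f" "x \<in> {a<..<b}" for f :: "real \<Rightarrow> 'h" and x
    using that continuous_on_interior[of "{a..b}" f x] by (simp add: interior_atLeastAtMost_real)
  obtain Z where Z: "\<And>x. x \<in> {a..b} \<Longrightarrow> norm (z x) \<le> Z"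
    using compact_imp_bounded[OF compact_continuous_image[OF cz compact_Icc]]
    unfolding bounded_iff by blast
  obtain G where G: "\<And>x. x \<in> {a..b} \<Longrightarrow> norm (g x) \<le> G"
    using compact_imp_bounded[OF compact_continuous_image[OF cg compact_Icc]]
    unfolding bounded_iff by blast
  \<comment> \<open>A third of the available room: shifts by up to \<open>2 * h0\<close> stay inside
    the open interval, which leaves space both for \<open>P n\<close> at \<open>r - h n\<close> and
    for products evaluated at \<open>r + h n\<close>.\<close>
  define h0 where "h0 = min (s - a) (b - t) / 3"
  have "3 * h0 = min (s - a) (b - t)" by (simp add: h0_def)
  then have "3 * h0 \<le> s - a" "3 * h0 \<le> b - t" "3 * h0 > 0" using st by auto
  then have h0: "h0 > 0" "a < s - 2 * h0" "t + 2 * h0 < b" by linarith+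
  define h where "h n = h0 / real (Suc n)" for n
  have h: "0 < h n" "h n \<le> h0" for n
    using h0(1) by (auto simp: h_def divide_simps)
  have hlim: "h \<longlonglongrightarrow> 0"
    using tendsto_mult_right_zero[OF LIMSEQ_inverse_real_of_nat, of h0] by (simp add: h_def[abs_def] divide_inverse)
  define v where "v n r = u (r + h n) - u (r - h n)" for n r
  \<comment> \<open>\<open>\<phi>\<close> pairs values at distance \<open>h n\<close>. By symmetry
    of the inner product, the terms without \<open>g\<close> in the tested equation add up to
    \<open>\<phi> n r - \<phi> n (r - h n)\<close>.\<close>
  define \<phi> where "\<phi> n r = z r \<bullet> z (r + h n) - S (u r) \<bullet> S (u (r + h n))" for n r
  define P where "P n x = integral {s - 2 * h0..x} (\<phi> n)" for n x
  have c\<phi>: "continuous_on {s - 2 * h0..t + h0} (\<phi> n)" for n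
  proof -
    have "continuous_on {s - 2 * h0..t + h0} (\<lambda>r. f (r + h n))" "continuous_on {s - 2 * h0..t + h0} f"
      if "continuous_on {a..b} f" for f :: "real \<Rightarrow> 'h"
      using h0 h[of n] by (auto intro!: continuous_on_compose2[OF that] continuous_on_subset[OF that] continuous_intros)
    from this[OF cz] this[OF cS] show ?thesis unfolding \<phi>_def by (intro continuous_intros)
  qed
  have Pd: "(P n has_real_derivative \<phi> n x) (at x)" if "x \<in> {s - 2 * h0<..<t + h0}" for n x
  proof -
    have "(P n has_real_derivative \<phi> n x) (at x within {s - 2 * h0..t + h0})"
      unfolding P_def using integral_has_real_derivative[OF c\<phi>] that by simp
    then show ?thesis using that at_within_interior[of x "{s - 2 * h0..t + h0}"]
      by (simp add: interior_atLeastAtMost_real)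
  qed
  \<comment> \<open>Subtracting a primitive of the telescoping terms leaves the force term as the
    whole derivative.\<close>
  define Q where "Q n r = z r \<bullet> v n r - (P n r - P n (r - h n))" for n r
  have Qd: "(Q n has_real_derivative g r \<bullet> v n r) (at r)" if r: "r \<in> {s..t}" for n r
  proof -
    have i: "r \<in> {a<..<b}" "r + h n \<in> {a<..<b}" "r - h n \<in> {a<..<b}"
      using r h0 h[of n] by auto
    have up: "((\<lambda>x. u (x + h n)) has_vector_derivative z (r + h n)) (at r)"
      by (rule has_vector_derivative_shift[OF ud[OF i(2)]])
    have um: "((\<lambda>x. u (x - h n)) has_vector_derivative z (r - h n)) (at r)"
      using has_vector_derivative_shift[of u _ r "- h n"] ud[OF i(3)] by simp
    have vd: "(v n has_vector_derivative z (r + h n) - z (r - h n)) (at r)"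
      unfolding v_def using has_vector_derivative_diff[OF up um] .
    have near: "\<forall>\<^sub>F x in at r. x + h n \<in> {a..b} \<and> x - h n \<in> {a..b}"
    proof -
      have "\<forall>\<^sub>F x in at r. x > a + h n" "\<forall>\<^sub>F x in at r. x < b - h n"
        using i by (auto intro!: order_tendstoD[OF tendsto_ident_at])
      then show ?thesis by eventually_elim (use h[of n] in auto)
    qed
    then have vV: "\<forall>\<^sub>F x in at r. v n x \<in> V"
      unfolding v_def by eventually_elim (use uV subspace_V in \<open>auto intro: subspace_diff\<close>)
    have Sv: "S (v n r) = S (u (r + h n)) - S (u (r - h n))"
      unfolding v_def using i by (intro S_diff uV) auto
    have "((\<lambda>x. S (u (x + h n)) - S (u (x - h n))) \<longlongrightarrow> S (u (r + h n)) - S (u (r - h n))) (at r)"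
      using isC[OF cS i(2)] isC[OF cS i(3)]
      by (intro tendsto_diff isCont_tendsto_compose[of _ "\<lambda>x. S (u x)"] tendsto_intros)
    moreover have "\<forall>\<^sub>F x in at r. S (u (x + h n)) - S (u (x - h n)) = S (v n x)"
      using near unfolding v_def by eventually_elim (use uV S_diff in auto)
    ultimately have Svl: "((\<lambda>x. S (v n x)) \<longlongrightarrow> S (v n r)) (at r)"
      unfolding Sv by (rule Lim_transform_eventually)
    have d1: "((\<lambda>x. z x \<bullet> v n x) has_real_derivative
        - (S (u r) \<bullet> S (v n r)) + g r \<bullet> v n r + z r \<bullet> (z (r + h n) - z (r - h n))) (at r)"
      by (rule dual_derivative_inner[OF zd[OF i(1)] vd vV Svl])
    have d2: "(P n has_real_derivative \<phi> n r) (at r)" using r h0 by (intro Pd) auto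
    have "(P n has_real_derivative \<phi> n (r - h n)) (at (r - h n))" using r h0 h[of n] by (intro Pd) auto
    then have d3: "((\<lambda>x. P n (x - h n)) has_real_derivative \<phi> n (r - h n)) (at r)"
      using DERIV_shift[of "P n" "\<phi> n (r - h n)" r "- h n"] by simp
    have e: "- (S (u r) \<bullet> S (v n r)) + g r \<bullet> v n r + z r \<bullet> (z (r + h n) - z (r - h n))
        - (\<phi> n r - \<phi> n (r - h n)) = g r \<bullet> v n r"
      unfolding Sv \<phi>_def by (simp add: inner_diff_right inner_commute)
    show ?thesis unfolding Q_def using DERIV_diff[OF d1 DERIV_diff[OF d2 d3]] unfolding e .
  qed
  define f where "f n r = g r \<bullet> ((1 / (2 * h n)) *\<^sub>R v n r)" for n r
  have fint: "(f n has_integral (Q n t - Q n s) / (2 * h n)) {s..t}" for n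
  proof -
    have "((\<lambda>r. g r \<bullet> v n r) has_integral (Q n t - Q n s)) {s..t}"
      using st Qd by (intro fundamental_theorem_of_calculus)
        (auto simp: has_real_derivative_iff_has_vector_derivative[symmetric] intro: has_field_derivative_at_within)
    from has_integral_mult_right[OF this, of "1 / (2 * h n)"] show ?thesis
      by (simp add: f_def[abs_def])
  qed
  have hat: "filterlim (\<lambda>n. r + c * h n) (at r) sequentially" if "c \<noteq> 0" for r c
    unfolding filterlim_at
  proof
    have "(\<lambda>n. r + c * h n) \<longlonglongrightarrow> r + c * 0" by (intro tendsto_intros hlim)
    then show "(\<lambda>n. r + c * h n) \<longlonglongrightarrow> r" by simp
    have "r + c * h n \<noteq> r" for n using h(1)[of n] that by auto
    then show "\<forall>\<^sub>F n in sequentially. r + c * h n \<in> UNIV \<and> r + c * h n \<noteq> r" by simp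
  qed
  have vlim: "(\<lambda>n. (1 / (2 * h n)) *\<^sub>R v n r) \<longlonglongrightarrow> z r" if r: "r \<in> {s..t}" for r
  proof -
    have "r \<in> {a<..<b}" using r st by auto
    note q = has_vector_derivative_quotient[OF ud[OF this]]
    have "(\<lambda>n. (1/2) *\<^sub>R ((1 / (r + 1 * h n - r)) *\<^sub>R (u (r + 1 * h n) - u r)
        + (1 / (r + (-1) * h n - r)) *\<^sub>R (u (r + (-1) * h n) - u r))) \<longlonglongrightarrow> (1/2) *\<^sub>R (z r + z r)"
      by (intro tendsto_intros filterlim_compose[OF q] hat) auto
    moreover have "(1/2) *\<^sub>R ((1 / (r + 1 * h n - r)) *\<^sub>R (u (r + 1 * h n) - u r)
        + (1 / (r + (-1) * h n - r)) *\<^sub>R (u (r + (-1) * h n) - u r)) = (1 / (2 * h n)) *\<^sub>R v n r" for n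
      unfolding v_def by (simp add: scaleR_diff_right scaleR_add_right)
    moreover have "(1/2) *\<^sub>R (z r + z r) = z r" by (simp flip: scaleR_2)
    ultimately show ?thesis by simp
  qed
  \<comment> \<open>The mean value inequality bounds the difference quotients uniformly in
    \<open>n\<close>, as dominated convergence requires.\<close>
  have vbound: "norm ((1 / (2 * h n)) *\<^sub>R v n r) \<le> Z" if r: "r \<in> {s..t}" for n r
  proof -
    have "norm (u (r + h n) - u (r - h n)) \<le> Z * norm ((r + h n) - (r - h n))"
    proof (rule differentiable_bound[of "{s - 2 * h0..t + 2 * h0}" u "\<lambda>x k. k *\<^sub>R z x"])
      fix x assume x: "x \<in> {s - 2 * h0..t + 2 * h0}"
      then have x': "x \<in> {a<..<b}" using h0 by auto
      show "(u has_derivative (\<lambda>k. k *\<^sub>R z x)) (at x within {s - 2 * h0..t + 2 * h0})"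
        using has_vector_derivative_at_within[OF ud[OF x']] by (simp add: has_vector_derivative_def)
      show "onorm (\<lambda>k. k *\<^sub>R z x) \<le> Z"
        using Z[of x] x' by (intro onorm_le) (auto simp: mult.commute[of Z] intro: mult_left_mono)
    qed (use r h0 h[of n] in auto)
    then have "norm (v n r) \<le> Z * (2 * h n)" using h(1)[of n] by (simp add: v_def)
    then show ?thesis using h(1)[of n] by (simp add: divide_simps)
  qed
  have fle: "norm (f n r) \<le> G * Z" if r: "r \<in> {s..t}" for n r
  proof -
    have "norm (f n r) \<le> norm (g r) * norm ((1 / (2 * h n)) *\<^sub>R v n r)"
      unfolding f_def real_norm_def by (rule Cauchy_Schwarz_ineq2)
    also have "\<dots> \<le> G * Z"
      using r st order_trans[OF norm_ge_zero G[of r]] by (intro mult_mono vbound G) auto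
    finally show ?thesis .
  qed
  have flim: "(\<lambda>n. f n r) \<longlonglongrightarrow> g r \<bullet> z r" if "r \<in> {s..t}" for r
    unfolding f_def by (intro tendsto_intros vlim that)
  note dom = dominated_convergence[OF has_integral_integrable[OF fint] integrable_const_ivl fle flim]
  have Qlim: "(\<lambda>n. Q n r / (2 * h n)) \<longlonglongrightarrow> wave_energy S u z r" if r: "r \<in> {s..t}" for r
  proof -
    \<comment> \<open>By the mean value theorem the increment of \<open>P n\<close> is
      \<open>h n * \<phi> n \<theta>\<close>. After division by \<open>2 * h n\<close> it tends to
      half of norm (z r)^2 - norm (S (u r))^2; taking this from norm (z r)^2 leaves the wave
      energy.\<close>
    have "\<exists>\<theta>. r - h n < \<theta> \<and> \<theta> < r \<and> P n r - P n (r - h n) = (r - (r - h n)) * \<phi> n \<theta>" for n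
      by (rule MVT2) (use h[of n] h0 r in \<open>auto intro!: Pd\<close>)
    then obtain \<theta> where \<theta>: "\<And>n. r - h n < \<theta> n" "\<And>n. \<theta> n < r"
      "\<And>n. P n r - P n (r - h n) = h n * \<phi> n (\<theta> n)" by (simp; metis)
    have thl: "\<theta> \<longlonglongrightarrow> r"
    proof (rule tendsto_sandwich[of "\<lambda>n. r - h n" \<theta> _ "\<lambda>_. r"])
      have "(\<lambda>n. r - h n) \<longlonglongrightarrow> r - 0" by (intro tendsto_intros hlim)
      then show "(\<lambda>n. r - h n) \<longlonglongrightarrow> r" by simp
    qed (use \<theta>(1,2) in \<open>auto intro!: always_eventually less_imp_le\<close>)
    have "(\<lambda>n. \<theta> n + h n) \<longlonglongrightarrow> r + 0" by (intro tendsto_intros thl hlim)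
    then have thl': "(\<lambda>n. \<theta> n + h n) \<longlonglongrightarrow> r" by simp
    have ri: "r \<in> {a<..<b}" using r st by auto
    have "(\<lambda>n. \<phi> n (\<theta> n)) \<longlonglongrightarrow> z r \<bullet> z r - S (u r) \<bullet> S (u r)"
      unfolding \<phi>_def
      by (intro tendsto_intros isCont_tendsto_compose[OF isC[OF cz ri]]
          isCont_tendsto_compose[OF isC[OF cS ri]] thl thl')
    then have "(\<lambda>n. z r \<bullet> ((1 / (2 * h n)) *\<^sub>R v n r) - (1/2) * \<phi> n (\<theta> n))
        \<longlonglongrightarrow> z r \<bullet> z r - (1/2) * (z r \<bullet> z r - S (u r) \<bullet> S (u r))"
      by (intro tendsto_intros vlim r)
    moreover have "z r \<bullet> ((1 / (2 * h n)) *\<^sub>R v n r) - (1/2) * \<phi> n (\<theta> n) = Q n r / (2 * h n)" for n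
      using h(1)[of n] by (simp add: Q_def \<theta>(3) field_simps)
    moreover have "z r \<bullet> z r - (1/2) * (z r \<bullet> z r - S (u r) \<bullet> S (u r)) = wave_energy S u z r"
      by (simp add: wave_energy_def power2_norm_eq_inner field_simps)
    ultimately show ?thesis by simp
  qed
  have "(\<lambda>n. Q n t / (2 * h n) - Q n s / (2 * h n)) \<longlonglongrightarrow> wave_energy S u z t - wave_energy S u z s"
    using st by (intro tendsto_diff Qlim) auto
  then have "(\<lambda>n. integral {s..t} (f n)) \<longlonglongrightarrow> wave_energy S u z t - wave_energy S u z s"
    using integral_unique[OF fint] by (simp add: diff_divide_distrib)
  with dom(2) have "integral {s..t} (\<lambda>r. g r \<bullet> z r) = wave_energy S u z t - wave_energy S u z s"
    by (rule LIMSEQ_unique)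
  then show ?thesis using integrable_integral[OF dom(1)] by simp
qed

text \<open>In the open interval the energy minus the work done by the force is constant; both are
  continuous on the closed interval, so the endpoints follow.\<close>

theorem energy_identity:
  assumes w: "weak_wave_on V S a b u z g" and st: "a \<le> s" "s \<le> t" "t \<le> b"
  shows "((\<lambda>r. g r \<bullet> z r) has_integral (wave_energy S u z t - wave_energy S u z s)) {s..t}"
proof (cases "s = t")
  case False
  then have lt: "s < t" using st by simp
  have w': "weak_wave_on V S s t u z g" using weak_wave_on_subinterval[OF w] st by blast
  have c: "continuous_on {s..t} (\<lambda>r. g r \<bullet> z r)"
    using w' by (auto simp: weak_wave_on_def intro!: continuous_intros)
  define I where "I x = integral {s..x} (\<lambda>r. g r \<bullet> z r)" for x
  have int: "(\<lambda>r. g r \<bullet> z r) integrable_on {x..y}" if "s \<le> x" "y \<le> t" for x y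
    using that by (intro integrable_continuous_real continuous_on_subset[OF c]) auto
  have cI: "continuous_on {s..t} I" unfolding I_def by (intro indefinite_integral_continuous_1 int) auto
  define m where "m = (s + t) / 2"
  have m: "s < m" "m < t" using lt by (auto simp: m_def)
  have "wave_energy S u z x - I x = wave_energy S u z m - I m" if x: "x \<in> {s<..<t}" for x
  proof -
    have *: "wave_energy S u z y - wave_energy S u z x = I y - I x" if "s < x" "x \<le> y" "y < t" for x y
    proof -
      have "I x + integral {x..y} (\<lambda>r. g r \<bullet> z r) = I y"
        unfolding I_def using that by (intro Henstock_Kurzweil_Integration.integral_combine int) auto
      then show ?thesis
        using integral_unique[OF energy_identity_interior[OF w' that]] by simp
    qed
    show ?thesis using *[of x m] *[of m x] x m by (cases "x \<le> m") auto
  qed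
  then have const: "wave_energy S u z x - I x = wave_energy S u z m - I m" if "x \<in> {s..t}" for x
    using continuous_constant_on_closure[of "{s<..<t}" "\<lambda>x. wave_energy S u z x - I x" "wave_energy S u z m - I m" x]
      continuous_on_diff[OF continuous_on_wave_energy[OF w'] cI] lt that by simp
  have "wave_energy S u z t - wave_energy S u z s = I t"
    using const[of s] const[of t] lt by (simp add: I_def)
  then show ?thesis using int[of s t] by (simp add: I_def has_integral_integral)
next
  case True
  then show ?thesis using has_integral_refl(2)[of _ s] by simp
qed

end

section \<open>Observability of perturbed waves\<close>

text \<open>Operator bounds hold only where a continuous extension agrees with the operator;
  continuity carries them to the endpoints.\<close>

lemma continuous_le_Icc:
  fixes f g :: "real \<Rightarrow> real"
  assumes "continuous_on {a..b} f" "continuous_on {a..b} g"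
    and le: "\<And>t. t \<in> {a<..<b} \<Longrightarrow> f t \<le> g t" and ab: "a < b" and t: "t \<in> {a..b}"
  shows "f t \<le> g t"
proof -
  have "f t - g t \<le> 0"
    by (rule continuous_le_on_closure[of "{a<..<b}" "\<lambda>t. f t - g t"])
      (use assms in \<open>auto intro!: continuous_on_diff\<close>)
  then show ?thesis by simp
qed

context compact_resolvent begin

text \<open>The energy identity is evaluated where the speed is maximal, and Young's inequality lets
  the maximum be absorbed on the left. The dependence on \<open>b - a\<close> is thus linear;
  integrating this bound once more over the interval produces the T^2 of the final
  denominator.\<close>

lemma velocity_bound:
  assumes w: "weak_wave_on V S a b u z g" and ab: "a < b" and x: "x \<in> {a..b}"
  shows "(norm (z x))\<^sup>2 \<le>
    4 * wave_energy S u z a + 4 * (b - a) * integral {a..b} (\<lambda>r. (norm (g r))\<^sup>2)"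
proof -
  have cz: "continuous_on {a..b} z" and cg: "continuous_on {a..b} g"
    using w by (auto simp: weak_wave_on_def)
  obtain y where y: "y \<in> {a..b}" and ymax: "\<And>r. r \<in> {a..b} \<Longrightarrow> norm (z r) \<le> norm (z y)"
    using continuous_attains_sup[OF compact_Icc _ continuous_on_norm[OF cz]] ab by auto
  define N where "N = norm (z y)"
  define T where "T = b - a"
  have T: "T > 0" using ab by (simp add: T_def)
  \<comment> \<open>Young weights chosen so that the first term integrates to N^2/4 over the whole
    interval, half of what N^2 <= 2 E can absorb.\<close>
  let ?k = "\<lambda>r. N\<^sup>2 / (4 * T) + T * (norm (g r))\<^sup>2"
  have ik: "?k integrable_on {p..q}" if "a \<le> p" "q \<le> b" for p q
    using that by (intro integrable_continuous_real continuous_intros continuous_on_subset[OF cg]) auto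
  have en: "((\<lambda>r. g r \<bullet> z r) has_integral (wave_energy S u z y - wave_energy S u z a)) {a..y}"
    using energy_identity[OF w, of a y] y by auto
  have pt: "g r \<bullet> z r \<le> ?k r" if "r \<in> {a..y}" for r
  proof -
    have "g r \<bullet> z r \<le> norm (g r) * norm (z r)" by (rule norm_cauchy_schwarz)
    also have "\<dots> \<le> norm (g r) * N"
      unfolding N_def using that y by (intro mult_left_mono ymax) auto
    also have "\<dots> \<le> ?k r"
    proof -
      have "0 \<le> (N - 2 * T * norm (g r))\<^sup>2" by simp
      then have "4 * T * (norm (g r) * N) \<le> N\<^sup>2 + (2 * T) * (2 * T) * (norm (g r))\<^sup>2"
        by (simp add: power2_eq_square algebra_simps)
      then have "norm (g r) * N \<le> (N\<^sup>2 + (2 * T) * (2 * T) * (norm (g r))\<^sup>2) / (4 * T)"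
        using T by (simp add: pos_le_divide_eq mult.commute)
      also have "\<dots> = ?k r" using T by (simp add: add_divide_distrib)
      finally show ?thesis .
    qed
    finally show ?thesis .
  qed
  have "wave_energy S u z y - wave_energy S u z a \<le> integral {a..y} ?k"
    using has_integral_le[OF en integrable_integral[OF ik] pt] y by auto
  also have "\<dots> \<le> integral {a..b} ?k"
    using y T by (intro integral_subset_le ik) auto
  also have "\<dots> = N\<^sup>2 / 4 + T * integral {a..b} (\<lambda>r. (norm (g r))\<^sup>2)"
  proof -
    have "integral {a..b} ?k = integral {a..b} (\<lambda>r. N\<^sup>2 / (4 * T)) + integral {a..b} (\<lambda>r. T * (norm (g r))\<^sup>2)"
      by (intro integral_add integrable_continuous_real continuous_intros cg)
    also have "integral {a..b} (\<lambda>r. N\<^sup>2 / (4 * T)) = N\<^sup>2 / 4"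
    proof -
      have "b = a + T" by (simp add: T_def)
      then show ?thesis using T by simp
    qed
    finally show ?thesis by simp
  qed
  finally have *: "4 * (wave_energy S u z y - wave_energy S u z a)
      \<le> N\<^sup>2 + 4 * T * integral {a..b} (\<lambda>r. (norm (g r))\<^sup>2)" by simp
  have "N\<^sup>2 \<le> 2 * wave_energy S u z y" unfolding N_def by (rule norm_velocity_le_energy)
  moreover have "(norm (z x))\<^sup>2 \<le> N\<^sup>2"
    unfolding N_def using ymax[OF x] by (intro power_mono) auto
  moreover have "n \<le> 4 * p + X" if "4 * (q - p) \<le> k + X" "k \<le> 2 * q" "n \<le> k" for k n p q X :: real
    using that by argo
  ultimately show ?thesis using * unfolding T_def by blast
qed

text \<open>The damped wave is compared with the free wave having (nearly) the same data; the
  difference is driven by the damping force, which \<open>\<iota>\<close> of the velocity controls.\<close>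

lemma observability_perturbed:
  fixes \<iota> :: "'h \<Rightarrow> 'w::real_normed_vector"
  assumes \<iota>: "bounded_linear \<iota>" "C > 0" "\<And>v. (norm (\<iota> v))\<^sup>2 \<le> C * (norm v)\<^sup>2"
    and c: "c > 0" and T: "T > 0"
    and obs: "\<And>w0 w1 w. w0 \<in> V \<Longrightarrow> free_wave_solution V S w0 w1 w \<Longrightarrow>
       1 / 2 * ((norm (S w0))\<^sup>2 + (norm w1)\<^sup>2) \<le>
         c * integral {0..T} (\<lambda>s. (norm (\<iota> (time_deriv w s)))\<^sup>2)"
    and w: "weak_wave_on V S a (a + T) u z g"
    and g: "\<And>r. r \<in> {a..a + T} \<Longrightarrow> (norm (g r))\<^sup>2 \<le> C * M\<^sup>2 * (norm (\<iota> (z r)))\<^sup>2"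
  shows "wave_energy S u z a \<le>
    4 * c * (1 + 4 * C\<^sup>2 * T\<^sup>2 * M\<^sup>2) * integral {a..a + T} (\<lambda>r. (norm (\<iota> (z r)))\<^sup>2)"
proof -
  define I where "I = integral {a..a + T} (\<lambda>r. (norm (\<iota> (z r)))\<^sup>2)"
  have cz: "continuous_on {a..a + T} z" and cg: "continuous_on {a..a + T} g"
    using w by (auto simp: weak_wave_on_def)
  have ci: "continuous_on X (\<lambda>r. (norm (\<iota> (f r)))\<^sup>2)" if "continuous_on X f" for X and f :: "real \<Rightarrow> 'h"
    by (intro continuous_intros bounded_linear.continuous_on[OF \<iota>(1)] that)
  have Ig: "integral {a..a + T} (\<lambda>r. (norm (g r))\<^sup>2) \<le> C * M\<^sup>2 * I"
  proof -
    have "integral {a..a + T} (\<lambda>r. (norm (g r))\<^sup>2)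
        \<le> integral {a..a + T} (\<lambda>r. C * M\<^sup>2 * (norm (\<iota> (z r)))\<^sup>2)"
      by (intro integral_le integrable_continuous_real continuous_intros cg ci cz g)
    then show ?thesis by (simp add: I_def)
  qed
  \<comment> \<open>\<open>L\<close> collects the coefficients of \<delta>^2: 16 c C T from the
    velocity error under the observability integral, 2 from replacing the data of the free wave by
    those of \<open>u\<close>.\<close>
  define L where "L = 16 * c * C * T + 2"
  have L: "L > 0" using c \<iota>(2) T by (simp add: L_def add_pos_pos)
  have key: "wave_energy S u z a \<le> 4 * c * (1 + 4 * C\<^sup>2 * T\<^sup>2 * M\<^sup>2) * I + L * \<delta>\<^sup>2" if \<delta>: "\<delta> > 0" for \<delta>
  proof -
    have uV: "u a \<in> V" using w T by (simp add: weak_wave_on_def)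
    obtain q y where q: "classical_wave q y" "norm (S (q 0 - u a)) < \<delta>" "norm (y 0 - z a) < \<delta>"
      using classical_wave_approx[OF uV \<delta>] by blast
    have qV: "q 0 \<in> V" using q(1) by (simp add: classical_wave_def)
    \<comment> \<open>The value of \<open>velocity_bound\<close> for the difference of the two
      waves, whose initial energy is at most \<delta>^2.\<close>
    define N where "N = 4 * \<delta>\<^sup>2 + 4 * T * (C * M\<^sup>2 * I)"
    have diff: "weak_wave_on V S a (a + T) (\<lambda>t. u t - q (t - a)) (\<lambda>t. z t - y (t - a)) g"
      by (rule weak_wave_on_diff[OF w classical_wave_shift[OF q(1)]])
    have e0: "wave_energy S (\<lambda>t. u t - q (t - a)) (\<lambda>t. z t - y (t - a)) a \<le> \<delta>\<^sup>2"
    proof -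
      have "norm (S (u a - q 0)) = norm (S (q 0 - u a))" using S_diff uV qV by (simp add: norm_minus_commute)
      then have "(norm (S (u a - q 0)))\<^sup>2 \<le> \<delta>\<^sup>2" "(norm (z a - y 0))\<^sup>2 \<le> \<delta>\<^sup>2"
        using q by (auto simp: norm_minus_commute intro!: power_mono)
      then show ?thesis by (simp add: wave_energy_def)
    qed
    have N: "(norm (z r - y (r - a)))\<^sup>2 \<le> N" if "r \<in> {a..a + T}" for r
    proof -
      have "(norm (z r - y (r - a)))\<^sup>2 \<le> 4 * wave_energy S (\<lambda>t. u t - q (t - a)) (\<lambda>t. z t - y (t - a)) a
          + 4 * (a + T - a) * integral {a..a + T} (\<lambda>r. (norm (g r))\<^sup>2)"
        using velocity_bound[OF diff _ that] T by simp
      also have "\<dots> \<le> 4 * \<delta>\<^sup>2 + 4 * (a + T - a) * (C * M\<^sup>2 * I)"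
        using T by (intro add_mono mult_left_mono e0 Ig) auto
      finally show ?thesis by (simp add: N_def)
    qed
    have sq: "(norm (p + r))\<^sup>2 \<le> 2 * (norm p)\<^sup>2 + 2 * (norm r)\<^sup>2" for p r :: "'x::real_normed_vector"
    proof -
      have "(norm (p + r))\<^sup>2 \<le> (norm p + norm r)\<^sup>2" by (intro power_mono norm_triangle_ineq) auto
      also have "\<dots> \<le> 2 * (norm p)\<^sup>2 + 2 * (norm r)\<^sup>2"
        using sum_squares_ge_zero[of "norm p - norm r" 0] by (simp add: power2_eq_square algebra_simps)
      finally show ?thesis .
    qed
    have pt: "(norm (\<iota> (y s)))\<^sup>2 \<le> 2 * (norm (\<iota> (z (a + s))))\<^sup>2 + 2 * C * N" if "s \<in> {0..T}" for s
    proof -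
      have "\<iota> (y s) = \<iota> (z (a + s)) + \<iota> (- (z (a + s) - y s))"
        by (simp flip: linear_simps(1)[OF \<iota>(1)])
      then have "(norm (\<iota> (y s)))\<^sup>2 \<le> 2 * (norm (\<iota> (z (a + s))))\<^sup>2 + 2 * (norm (\<iota> (- (z (a + s) - y s))))\<^sup>2"
        using sq by metis
      also have "(norm (\<iota> (- (z (a + s) - y s))))\<^sup>2 \<le> C * (norm (- (z (a + s) - y s)))\<^sup>2" by (rule \<iota>(3))
      also have "(norm (- (z (a + s) - y s)))\<^sup>2 \<le> N"
        using N[of "a + s"] that by (simp only: norm_minus_cancel) simp
      finally show ?thesis using \<iota>(2) by simp
    qed
    have cza: "continuous_on {0..T} (\<lambda>s. z (a + s))"
      by (rule continuous_on_compose2[OF cz]) (auto intro!: continuous_intros)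
    have "1 / 2 * ((norm (S (q 0)))\<^sup>2 + (norm (y 0))\<^sup>2)
        \<le> c * integral {0..T} (\<lambda>s. (norm (\<iota> (time_deriv q s)))\<^sup>2)"
      by (rule obs[OF qV free_wave_solution_classical[OF q(1)]])
    also have "integral {0..T} (\<lambda>s. (norm (\<iota> (time_deriv q s)))\<^sup>2) = integral {0..T} (\<lambda>s. (norm (\<iota> (y s)))\<^sup>2)"
      by (rule integral_cong) (simp add: classical_wave_time_deriv[OF q(1)])
    also have "\<dots> \<le> integral {0..T} (\<lambda>s. 2 * (norm (\<iota> (z (a + s))))\<^sup>2 + 2 * C * N)"
      by (intro integral_le integrable_continuous_real continuous_on_add continuous_on_mult
          continuous_on_const ci cza continuous_on_velocity[OF q(1)] pt)
    also have "\<dots> = 2 * integral {0..T} (\<lambda>s. (norm (\<iota> (z (a + s))))\<^sup>2) + T * (2 * C * N)"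
      using T by (subst integral_add) (auto intro!: integrable_continuous_real continuous_intros ci cza)
    also have "integral {0..T} (\<lambda>s. (norm (\<iota> (z (a + s))))\<^sup>2) = I"
      using integral_shift_Icc_real[of 0 T "\<lambda>r. (norm (\<iota> (z r)))\<^sup>2" a]
      unfolding I_def by (simp add: o_def add.commute)
    finally have b: "(norm (S (q 0)))\<^sup>2 + (norm (y 0))\<^sup>2 \<le> 2 * (c * (2 * I + T * (2 * C * N)))"
      using c by simp
    have "(norm (S (u a)))\<^sup>2 \<le> 2 * (norm (S (q 0)))\<^sup>2 + 2 * \<delta>\<^sup>2"
    proof -
      have "S (u a) = S (q 0) + - S (q 0 - u a)" using S_diff[OF qV uV] by simp
      then have "(norm (S (u a)))\<^sup>2 \<le> 2 * (norm (S (q 0)))\<^sup>2 + 2 * (norm (- S (q 0 - u a)))\<^sup>2"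
        using sq by metis
      also have "(norm (- S (q 0 - u a)))\<^sup>2 \<le> \<delta>\<^sup>2" using q(2) by (intro power_mono) auto
      finally show ?thesis by simp
    qed
    moreover have "(norm (z a))\<^sup>2 \<le> 2 * (norm (y 0))\<^sup>2 + 2 * \<delta>\<^sup>2"
    proof -
      have "z a = y 0 + - (y 0 - z a)" by simp
      then have "(norm (z a))\<^sup>2 \<le> 2 * (norm (y 0))\<^sup>2 + 2 * (norm (- (y 0 - z a)))\<^sup>2"
        using sq by metis
      also have "(norm (- (y 0 - z a)))\<^sup>2 \<le> \<delta>\<^sup>2"
        using q(3) unfolding norm_minus_cancel by (intro power_mono) auto
      finally show ?thesis by simp
    qed
    \<comment> \<open>The factor 4 c stems from applying (p + r)^2 <= 2 p^2 + 2 r^2 twice, to the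
      data and to the observed velocity. The force part 4 T C M^2 I of \<open>N\<close> contributes
      16 c C^2 T^2 M^2 I, which is 4 c times the second summand of the bracket.\<close>
    ultimately have "wave_energy S u z a \<le> 2 * (c * (2 * I + T * (2 * C * N))) + 2 * \<delta>\<^sup>2"
      using b unfolding wave_energy_def by simp
    also have "\<dots> = 4 * c * (1 + 4 * C\<^sup>2 * T\<^sup>2 * M\<^sup>2) * I + L * \<delta>\<^sup>2"
      unfolding N_def L_def by (simp add: power2_eq_square algebra_simps)
    finally show ?thesis .
  qed
  \<comment> \<open>The approximation of the data is arbitrary; \<delta> is taken with L \<delta>^2
    = e.\<close>
  have "wave_energy S u z a \<le> 4 * c * (1 + 4 * C\<^sup>2 * T\<^sup>2 * M\<^sup>2) * I"
  proof (rule field_le_epsilon)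
    fix e :: real assume "e > 0"
    then show "wave_energy S u z a \<le> 4 * c * (1 + 4 * C\<^sup>2 * T\<^sup>2 * M\<^sup>2) * I + e"
      using key[of "sqrt (e / L)"] L by simp
  qed
  then show ?thesis by (simp add: I_def)
qed

end

section \<open>The delayed problem\<close>

lemma integral_le_except_right:
  fixes f g :: "real \<Rightarrow> real"
  assumes f: "f integrable_on {s..t}" and g: "g integrable_on {s..t}"
    and le: "\<And>r. r \<in> {s..<t} \<Longrightarrow> f r \<le> g r"
  shows "integral {s..t} f \<le> integral {s..t} g"
proof (rule has_integral_le[OF _ integrable_integral[OF g]])
  show "(f(t := g t) has_integral integral {s..t} f) {s..t}"
    by (rule has_integral_spike_finite[OF _ _ integrable_integral[OF f], of "{t}"]) auto
qed (use le in auto)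

text \<open>\<open>E\<close> is known only through an integral inequality, so the argument runs on
  its differentiable majorant \<open>G\<close>; the exponential in \<open>W\<close> is the
  integrating factor.\<close>

lemma gronwall_energy:
  fixes E p :: "real \<Rightarrow> real"
  assumes c: "continuous_on {a..b} p" and K: "K \<ge> 0"
    and E: "\<And>t. t \<in> {a..b} \<Longrightarrow> E t \<le> E a + K * integral {a..t} p"
    and p: "\<And>t. t \<in> {a..b} \<Longrightarrow> p t \<le> 2 * E t" and t: "t \<in> {a..b}"
  shows "E t \<le> exp (2 * K * (t - a)) * E a"
proof -
  define G where "G x = E a + K * integral {a..x} p" for x
  define W where "W x = exp (- 2 * K * (x - a)) * G x" for x
  have Gd: "(G has_real_derivative K * p x) (at x within {a..b})" if "x \<in> {a..b}" for x
    unfolding G_def using integral_has_real_derivative[OF c that]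
    by (auto intro!: derivative_eq_intros)
  have Wd: "(W has_real_derivative exp (- 2 * K * (x - a)) * (K * (p x - 2 * G x))) (at x within {a..b})"
    if "x \<in> {a..b}" for x
  proof -
    have "((\<lambda>x. exp (- 2 * K * (x - a))) has_real_derivative exp (- 2 * K * (x - a)) * (- 2 * K))
        (at x within {a..b})"
      by (auto intro!: derivative_eq_intros)
    from DERIV_mult[OF this Gd[OF that]] show ?thesis
      unfolding W_def by (simp add: algebra_simps)
  qed
  have "W t \<le> W a"
  proof (rule DERIV_nonpos_imp_decreasing_open[of a t W])
    show "a \<le> t" using t by simp
    show "continuous_on {a..t} W"
      using t by (intro continuous_on_subset[OF DERIV_continuous_on[OF Wd]]) auto
    fix x assume x: "a < x" "x < t"
    then have x': "x \<in> {a..b}" using t by auto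
    have "(W has_real_derivative exp (- 2 * K * (x - a)) * (K * (p x - 2 * G x))) (at x)"
      using Wd[OF x'] at_within_interior[of x "{a..b}"] x t by (simp add: interior_atLeastAtMost_real)
    moreover have "K * (p x - 2 * G x) \<le> 0"
      using p[OF x'] E[OF x'] K unfolding G_def by (intro mult_nonneg_nonpos) auto
    then have "exp (- 2 * K * (x - a)) * (K * (p x - 2 * G x)) \<le> 0"
      by (rule mult_nonneg_nonpos[OF exp_ge_zero])
    ultimately show "\<exists>y. (W has_real_derivative y) (at x) \<and> y \<le> 0" by blast
  qed
  then have "exp (2 * K * (t - a)) * W t \<le> exp (2 * K * (t - a)) * E a"
    by (intro mult_left_mono) (auto simp: W_def G_def)
  moreover have "exp (2 * K * (t - a)) * W t = G t"
    by (simp add: W_def mult.assoc[symmetric] exp_add[symmetric])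
  ultimately show ?thesis using E[OF t] by (simp add: G_def)
qed

lemma adjoint_zero_blinfun:
  fixes y :: "'b::real_inner"
  shows "adjoint (blinfun_apply (0 :: 'a::{real_inner,complete_space} \<Rightarrow>\<^sub>L 'b)) y = 0"
  using norm_blinfun_adjoint_le[of 0 y] by simp

text \<open>One solution \<open>u\<close> is fixed. \<open>xi(2)\<close> is the bound of \<xi> by
  the infimum of m_2n / M_2n+1, cleared of denominators.\<close>

locale switched_wave = compact_resolvent V S R
  for V :: "'h::{real_inner,complete_space} set" and S R +
  fixes \<iota> :: "'h \<Rightarrow> 'w::real_normed_vector" and C \<tau> \<xi> :: real and tt m M :: "nat \<Rightarrow> real"
    and B1 :: "real \<Rightarrow> 'u1::{real_inner,complete_space} \<Rightarrow>\<^sub>L 'h"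
    and B2 :: "real \<Rightarrow> 'u2::{real_inner,complete_space} \<Rightarrow>\<^sub>L 'h" and u :: "real \<Rightarrow> 'h"
  assumes iota: "bounded_linear \<iota>" "C > 0" "\<And>v. (norm (\<iota> v))\<^sup>2 \<le> C * (norm v)\<^sup>2"
    and tau: "\<tau> > 0"
    and times: "tt 0 = 0" "\<And>n. tt n < tt (n + 1)" "\<And>n. tt (2 * n) + \<tau> \<le> tt (2 * n + 1)"
    and B_zero: "\<And>n t. t \<in> {tt (2 * n)..<tt (2 * n + 1)} \<Longrightarrow> B2 t = 0"
      "\<And>n t. t \<in> {tt (2 * n + 1)..<tt (2 * n + 2)} \<Longrightarrow> B1 t = 0"
    and B_cont: "\<And>n. cont_up_to (tt (2 * n)) (tt (2 * n + 1)) B1"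
      "\<And>n. cont_up_to (tt (2 * n + 1)) (tt (2 * n + 2)) B2"
    and mM: "\<And>n. 0 < m (2 * n)" "\<And>n. m (2 * n) \<le> M (2 * n)" "\<And>n. 0 < M (2 * n + 1)"
    and B1_bounds: "\<And>n t v. t \<in> {tt (2 * n)..<tt (2 * n + 1)} \<Longrightarrow>
        m (2 * n) * (norm (\<iota> v))\<^sup>2 \<le> (norm (adjoint (blinfun_apply (B1 t)) v))\<^sup>2 \<and>
        (norm (adjoint (blinfun_apply (B1 t)) v))\<^sup>2 \<le> M (2 * n) * (norm (\<iota> v))\<^sup>2"
    and B2_bound: "\<And>n t v. t \<in> {tt (2 * n + 1)..<tt (2 * n + 2)} \<Longrightarrow>
        (norm (adjoint (blinfun_apply (B2 t)) v))\<^sup>2 \<le> M (2 * n + 1) * (norm (\<iota> v))\<^sup>2"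
    and xi: "\<xi> > 0" "\<And>n. \<xi> * M (2 * n + 1) \<le> m (2 * n)"
    and u_class: "energy_class V S u"
    and u_eq: "\<And>t. t > 0 \<Longrightarrow> t \<notin> range tt \<Longrightarrow> has_dual_derivative V S (time_deriv u)
          (\<lambda>v. - inner (S (u t)) (S v)
               - inner (blinfun_apply (B1 t) (adjoint (blinfun_apply (B1 t)) (time_deriv u t))) v
               - inner (blinfun_apply (B2 t) (adjoint (blinfun_apply (B2 t)) (time_deriv u (t - \<tau>)))) v) t"
begin

abbreviation "z \<equiv> time_deriv u"
abbreviation "E \<equiv> energy S \<tau> \<xi> B2 u"

text \<open>With r = s + \<tau> the memory term of the energy becomes the integral of this function
  over [t, t + \<tau>]; in this form the integrand vanishes on the undelayed intervals.\<close>

definition delay :: "real \<Rightarrow> real" where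
  "delay r = (norm (adjoint (blinfun_apply (B2 r)) (z (r - \<tau>))))\<^sup>2"

lemma tt_less: "i < j \<Longrightarrow> tt i < tt j"
  using lift_Suc_mono_less[of tt] times(2) by (metis Suc_eq_plus1)

lemma tt_le: "i \<le> j \<Longrightarrow> tt i \<le> tt j"
  using tt_less[of i j] by (cases "i = j") auto

lemma tt_nonneg: "tt n \<ge> 0"
  using tt_le[of 0 n] times(1) by simp

lemma tt_unbounded: "\<exists>n. x \<le> tt (2 * n)"
proof -
  have "real n * \<tau> \<le> tt (2 * n)" for n
  proof (induction n)
    case (Suc n)
    have "tt (2 * n) + \<tau> \<le> tt (2 * n + 1)" "tt (2 * n + 1) \<le> tt (2 * Suc n)"
      using times(3) tt_le[of "2 * n + 1" "2 * Suc n"] by auto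
    then show ?case using Suc by (simp add: algebra_simps)
  qed (simp add: times)
  moreover obtain n where "x / \<tau> \<le> real n" using real_arch_simple by blast
  then have "x \<le> real n * \<tau>" using tau by (simp add: divide_le_eq)
  ultimately show ?thesis using order_trans by blast
qed

lemma not_switching_time: "tt n < t \<Longrightarrow> t < tt (n + 1) \<Longrightarrow> t \<notin> range tt"
proof
  assume t: "tt n < t" "t < tt (n + 1)" and "t \<in> range tt"
  then obtain k where k: "t = tt k" by auto
  show False
  proof (cases "k \<le> n")
    case True
    then show False using tt_le[OF True] t k by simp
  next
    case False
    then have "tt (n + 1) \<le> tt k" by (intro tt_le) simp
    then show False using t k by simp
  qed
qed

lemma velocity: "t > 0 \<Longrightarrow> (u has_vector_derivative z t) (at t)"
proof -
  assume t: "t > 0"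
  have "u differentiable (at t within {0..})" using u_class t by (simp add: energy_class_def)
  then have "(u has_vector_derivative z t) (at t within {0..})"
    unfolding time_deriv_def by (simp add: vector_derivative_works)
  moreover have "at t within {0..} = at t"
    using t by (intro at_within_interior) simp
  ultimately show ?thesis by simp
qed

lemma cont_z: "X \<subseteq> {0..} \<Longrightarrow> continuous_on X z"
  using u_class continuous_on_subset by (auto simp: energy_class_def)

lemma cont_iota_z: "X \<subseteq> {0..} \<Longrightarrow> continuous_on X (\<lambda>r. (norm (\<iota> (z r)))\<^sup>2)"
  by (intro continuous_intros bounded_linear.continuous_on[OF iota(1)] cont_z)

lemma cont_z_delayed: "X \<subseteq> {\<tau>..} \<Longrightarrow> continuous_on X (\<lambda>r. z (r - \<tau>))"
  by (rule continuous_on_compose2[OF cont_z[OF order_refl]]) (auto intro!: continuous_intros)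

text \<open>The force has to agree with \<open>g\<close> only in the interior; this is how the
  continuous extensions of \<open>B1\<close> and \<open>B2\<close> to a right endpoint
  enter.\<close>

lemma weak_wave_on_piece:
  assumes ab: "0 \<le> a" "continuous_on {a..b} g"
    and eq: "\<And>t v. t \<in> {a<..<b} \<Longrightarrow> t \<notin> range tt \<and> g t =
        - blinfun_apply (B1 t) (adjoint (blinfun_apply (B1 t)) (z t))
        - blinfun_apply (B2 t) (adjoint (blinfun_apply (B2 t)) (z (t - \<tau>)))"
  shows "weak_wave_on V S a b u z g"
proof -
  have uV: "u t \<in> V" if "t \<ge> 0" for t using u_class that by (simp add: energy_class_def)
  have "continuous_on {0..} (\<lambda>t. S (u t))"
    unfolding continuous_on_def
  proof
    fix t :: real assume t: "t \<in> {0..}"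
    have "((\<lambda>s. norm (S (u s - u t))) \<longlongrightarrow> 0) (at t within {0..})"
      using u_class t by (simp add: energy_class_def)
    then have "((\<lambda>s. S (u s - u t)) \<longlongrightarrow> 0) (at t within {0..})" by (rule tendsto_norm_zero_cancel)
    moreover have "\<forall>\<^sub>F s in at t within {0..}. S (u s - u t) = S (u s) - S (u t)"
      using t S_diff uV by (auto simp: eventually_at_filter)
    ultimately have "((\<lambda>s. S (u s) - S (u t)) \<longlongrightarrow> 0) (at t within {0..})"
      by (rule Lim_transform_eventually)
    then show "((\<lambda>s. S (u s)) \<longlongrightarrow> S (u t)) (at t within {0..})" by (simp add: Lim_null[symmetric])
  qed
  then have cS: "continuous_on {a..b} (\<lambda>t. S (u t))" by (rule continuous_on_subset) (use ab in auto)
  have "has_dual_derivative V S z (\<lambda>v. - (S (u t) \<bullet> S v) + g t \<bullet> v) t" if t: "t \<in> {a<..<b}" for t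
  proof (rule has_dual_derivative_cong_ev[OF u_eq])
    show "t > 0" "t \<notin> range tt" using t ab eq[OF t] by auto
    show "- (S (u t) \<bullet> S v)
        - blinfun_apply (B1 t) (adjoint (blinfun_apply (B1 t)) (z t)) \<bullet> v
        - blinfun_apply (B2 t) (adjoint (blinfun_apply (B2 t)) (z (t - \<tau>))) \<bullet> v
        = - (S (u t) \<bullet> S v) + g t \<bullet> v" for v
      using eq[OF t] by (simp add: inner_diff_left)
  qed auto
  then show ?thesis
    unfolding weak_wave_on_def using ab cS uV velocity cont_z[of "{a..b}"] by auto
qed

text \<open>The assumption bounds the adjoint only. Duality passes the bound to \<open>B1 t\<close>
  itself: norm (B x)^2 is the inner product of x and B* B x, and the bound on B* B x lets one factor
  norm (B x)^2 cancel. Each of B and B* contributes one factor M.\<close>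

lemma damping_force:
  assumes "t \<in> {tt (2 * n)..<tt (2 * n + 1)}"
  shows "(norm (blinfun_apply (B1 t) (adjoint (blinfun_apply (B1 t)) v)))\<^sup>2
    \<le> C * (M (2 * n))\<^sup>2 * (norm (\<iota> v))\<^sup>2"
proof -
  let ?B = "blinfun_apply (B1 t)" and ?M = "M (2 * n)"
  have M: "?M > 0" using mM(1,2)[of n] by simp
  have up: "(norm (adjoint ?B y))\<^sup>2 \<le> ?M * (norm (\<iota> y))\<^sup>2" for y using B1_bounds[OF assms] by blast
  have "(norm (?B x))\<^sup>2 \<le> ?M * C * (norm x)\<^sup>2" for x
  proof (cases "?B x = 0")
    case False
    have "(norm (?B x))\<^sup>2 = x \<bullet> adjoint ?B (?B x)"
      by (simp add: power2_norm_eq_inner blinfun_adjoint_inner)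
    also have "\<dots> \<le> norm x * norm (adjoint ?B (?B x))" by (rule norm_cauchy_schwarz)
    finally have "((norm (?B x))\<^sup>2)\<^sup>2 \<le> (norm x * norm (adjoint ?B (?B x)))\<^sup>2" by (intro power_mono) auto
    also have "\<dots> = (norm x)\<^sup>2 * (norm (adjoint ?B (?B x)))\<^sup>2" by (rule power_mult_distrib)
    also have "\<dots> \<le> (norm x)\<^sup>2 * (?M * (C * (norm (?B x))\<^sup>2))"
      using M by (intro mult_left_mono order_trans[OF up] iota(3)) auto
    finally have "(norm (?B x))\<^sup>2 * (norm (?B x))\<^sup>2 \<le> (?M * C * (norm x)\<^sup>2) * (norm (?B x))\<^sup>2"
      by (simp add: power2_eq_square mult_ac)
    moreover have "(norm (?B x))\<^sup>2 > 0" using False by simp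
    ultimately show ?thesis by (rule mult_right_le_imp_le)
  qed (use M iota(2) in simp)
  then have "(norm (?B (adjoint ?B v)))\<^sup>2 \<le> ?M * C * (norm (adjoint ?B v))\<^sup>2" .
  also have "\<dots> \<le> ?M * C * (?M * (norm (\<iota> v))\<^sup>2)" using M iota(2) by (intro mult_left_mono up) auto
  finally show ?thesis by (simp add: power2_eq_square mult_ac)
qed

text \<open>The first bound feeds the comparison with free waves, the second the dissipation of
  energy.\<close>

lemma even_wave:
  "\<exists>g. weak_wave_on V S (tt (2 * n)) (tt (2 * n + 1)) u z g \<and>
    (\<forall>r\<in>{tt (2 * n)..tt (2 * n + 1)}.
      (norm (g r))\<^sup>2 \<le> C * (M (2 * n))\<^sup>2 * (norm (\<iota> (z r)))\<^sup>2 \<and>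
      g r \<bullet> z r \<le> - m (2 * n) * (norm (\<iota> (z r)))\<^sup>2)"
proof -
  let ?a = "tt (2 * n)" and ?b = "tt (2 * n + 1)"
  have a: "?a \<ge> 0" "?a < ?b" using tt_nonneg times(2) by auto
  obtain B where B: "continuous_on {?a..?b} B" "\<And>t. t \<in> {?a..<?b} \<Longrightarrow> B t = B1 t"
    using B_cont(1)[of n] by (auto simp: cont_up_to_def)
  define g where "g t = - blinfun_apply (B t) (adjoint (blinfun_apply (B t)) (z t))" for t
  have cz: "continuous_on {?a..?b} z" using a by (intro cont_z) auto
  have cg: "continuous_on {?a..?b} g"
    unfolding g_def by (intro continuous_intros continuous_on_blinfun_adjoint B cz)
  have ci: "continuous_on {?a..?b} (\<lambda>r. (norm (\<iota> (z r)))\<^sup>2)" using a by (intro cont_iota_z) auto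
  have w: "weak_wave_on V S ?a ?b u z g"
  proof (rule weak_wave_on_piece[OF a(1) cg])
    fix t v assume t: "t \<in> {?a<..<?b}"
    then show "t \<notin> range tt \<and> g t = - blinfun_apply (B1 t) (adjoint (blinfun_apply (B1 t)) (z t))
        - blinfun_apply (B2 t) (adjoint (blinfun_apply (B2 t)) (z (t - \<tau>)))"
      using not_switching_time[of "2 * n" t] B_zero(1)[of t n] B(2)[of t] by (auto simp: g_def)
  qed
  have b: "(norm (g r))\<^sup>2 \<le> C * (M (2 * n))\<^sup>2 * (norm (\<iota> (z r)))\<^sup>2" if "r \<in> {?a..?b}" for r
  proof (rule continuous_le_Icc[OF _ _ _ a(2) that])
    show "continuous_on {?a..?b} (\<lambda>r. (norm (g r))\<^sup>2)" by (intro continuous_intros cg)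
    show "continuous_on {?a..?b} (\<lambda>r. C * (M (2 * n))\<^sup>2 * (norm (\<iota> (z r)))\<^sup>2)"
      by (intro continuous_on_mult continuous_on_const ci)
    fix t assume t: "t \<in> {?a<..<?b}"
    then show "(norm (g t))\<^sup>2 \<le> C * (M (2 * n))\<^sup>2 * (norm (\<iota> (z t)))\<^sup>2"
      using damping_force[of t n "z t"] B(2)[of t] by (simp add: g_def)
  qed
  have d: "g r \<bullet> z r \<le> - m (2 * n) * (norm (\<iota> (z r)))\<^sup>2" if "r \<in> {?a..?b}" for r
  proof (rule continuous_le_Icc[OF _ _ _ a(2) that])
    fix t assume t: "t \<in> {?a<..<?b}"
    have "g t \<bullet> z t = - (norm (adjoint (blinfun_apply (B1 t)) (z t)))\<^sup>2"
      using t B(2)[of t] by (simp add: g_def blinfun_adjoint_inner power2_norm_eq_inner)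
    then show "g t \<bullet> z t \<le> - m (2 * n) * (norm (\<iota> (z t)))\<^sup>2"
      using B1_bounds[of t n "z t"] t by simp
  qed (intro continuous_intros cg ci cz)+
  show ?thesis using w b d by blast
qed

text \<open>The weight in Young's inequality gives the delayed velocity the coefficient \<xi>/2,
  exactly the rate at which the memory term of the energy releases \<open>delay r\<close>; the two
  cancel in \<open>odd_step\<close>.\<close>

lemma odd_wave:
  "\<exists>g. weak_wave_on V S (tt (2 * n + 1)) (tt (2 * n + 2)) u z g \<and>
    (\<forall>r\<in>{tt (2 * n + 1)..<tt (2 * n + 2)}.
      g r \<bullet> z r \<le> \<xi> / 2 * delay r + C * M (2 * n + 1) / (2 * \<xi>) * (norm (z r))\<^sup>2)"
proof -
  let ?a = "tt (2 * n + 1)" and ?b = "tt (2 * n + 2)"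
  \<comment> \<open>Every undelayed interval has length at least \<tau>, so the delayed times
    \<open>r - \<tau>\<close> are nonnegative, where \<open>z\<close> is specified.\<close>
  have a: "?a \<ge> \<tau>" "?a \<ge> 0" using times(3)[of n] tt_nonneg[of "2 * n"] tau by linarith+
  obtain B where B: "continuous_on {?a..?b} B" "\<And>t. t \<in> {?a..<?b} \<Longrightarrow> B t = B2 t"
    using B_cont(2)[of n] by (auto simp: cont_up_to_def)
  define g where "g t = - blinfun_apply (B t) (adjoint (blinfun_apply (B t)) (z (t - \<tau>)))" for t
  have cg: "continuous_on {?a..?b} g"
    unfolding g_def using a by (intro continuous_intros continuous_on_blinfun_adjoint B cont_z_delayed) auto
  have w: "weak_wave_on V S ?a ?b u z g"
  proof (rule weak_wave_on_piece[OF a(2) cg])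
    fix t v assume t: "t \<in> {?a<..<?b}"
    then show "t \<notin> range tt \<and> g t = - blinfun_apply (B1 t) (adjoint (blinfun_apply (B1 t)) (z t))
        - blinfun_apply (B2 t) (adjoint (blinfun_apply (B2 t)) (z (t - \<tau>)))"
      using not_switching_time[of "2 * n + 1" t] B_zero(2)[of t n] B(2)[of t] by (auto simp: g_def)
  qed
  have d: "g r \<bullet> z r \<le> \<xi> / 2 * delay r + C * M (2 * n + 1) / (2 * \<xi>) * (norm (z r))\<^sup>2"
    if r: "r \<in> {?a..<?b}" for r
  proof -
    let ?p = "adjoint (blinfun_apply (B2 r)) (z (r - \<tau>))" and ?q = "adjoint (blinfun_apply (B2 r)) (z r)"
    have "g r \<bullet> z r = - (?p \<bullet> ?q)" using B(2)[OF r] by (simp add: g_def blinfun_adjoint_inner)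
    also have "\<dots> \<le> \<xi> / 2 * (norm ?p)\<^sup>2 + 1 / (2 * \<xi>) * (norm ?q)\<^sup>2"
    proof -
      have "0 \<le> (norm (\<xi> *\<^sub>R ?p + ?q))\<^sup>2" by simp
      also have "\<dots> = \<xi> * \<xi> * (norm ?p)\<^sup>2 + 2 * \<xi> * (?p \<bullet> ?q) + (norm ?q)\<^sup>2"
        unfolding power2_norm_eq_inner by (simp add: inner_add_left inner_add_right inner_commute algebra_simps)
      finally have "- (?p \<bullet> ?q) \<le> (\<xi> * \<xi> * (norm ?p)\<^sup>2 + (norm ?q)\<^sup>2) / (2 * \<xi>)"
        using xi(1) by (simp add: pos_le_divide_eq algebra_simps)
      also have "\<dots> = \<xi> / 2 * (norm ?p)\<^sup>2 + 1 / (2 * \<xi>) * (norm ?q)\<^sup>2"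
        using xi(1) by (simp add: add_divide_distrib)
      finally show ?thesis .
    qed
    also have "(norm ?q)\<^sup>2 \<le> M (2 * n + 1) * (C * (norm (z r))\<^sup>2)"
      using mM(3)[of n] by (intro order_trans[OF B2_bound[OF r]] mult_left_mono iota(3)) auto
    finally show ?thesis using xi(1) by (simp add: delay_def mult_ac divide_right_mono)
  qed
  show ?thesis using w d by blast
qed

section \<open>The delay integrand and its shift by \<tau>\<close>

lemma delay_nonneg: "delay r \<ge> 0"
  by (simp add: delay_def)

lemma delay_even: "r \<in> {tt (2 * n)..<tt (2 * n + 1)} \<Longrightarrow> delay r = 0"
  using B_zero(1)[of r n] by (simp add: delay_def adjoint_zero_blinfun)

text \<open>The undelayed interval starting at t_2n+2 has length at least \<tau>, so a time before
  t_2n+2 is shifted to a time before t_2n+3. The only nonzero \<open>B2\<close> it can meet is the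
  one between t_2n+1 and t_2n+2.\<close>

lemma delay_shift:
  assumes r: "r \<in> {tt (2 * n)..<tt (2 * n + 2)}"
  shows "delay (r + \<tau>) \<le> M (2 * n + 1) * (norm (\<iota> (z r)))\<^sup>2"
proof -
  have nn: "0 \<le> M (2 * n + 1) * (norm (\<iota> (z r)))\<^sup>2"
    using mM(3)[of n] by (intro mult_nonneg_nonneg) auto
  have "r + \<tau> < tt (2 * (n + 1) + 1)" using times(3)[of "n + 1"] r by simp
  then consider "r + \<tau> < tt (2 * n + 1)" | "r + \<tau> \<in> {tt (2 * n + 1)..<tt (2 * n + 2)}"
    | "r + \<tau> \<in> {tt (2 * (n + 1))..<tt (2 * (n + 1) + 1)}" by force
  then show ?thesis
  proof cases
    case 1
    then have "delay (r + \<tau>) = 0" using r tau by (intro delay_even[of _ n]) auto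
    then show ?thesis using nn by simp
  next
    case 2
    then show ?thesis using B2_bound[of "r + \<tau>" n "z r"] by (simp add: delay_def)
  next
    case 3
    then have "delay (r + \<tau>) = 0" by (rule delay_even)
    then show ?thesis using nn by simp
  qed
qed

lemma delay_integrable_piece: "delay integrable_on {tt k..tt (k + 1)}"
proof (cases "even k")
  case True
  then obtain n where k: "k = 2 * n" by blast
  show ?thesis
    by (rule integrable_spike_finite[of "{tt (k + 1)}" _ _ "\<lambda>_. 0"]) (auto simp: k intro!: delay_even)
next
  case False
  then obtain n where k: "k = 2 * n + 1" by (metis oddE)
  let ?a = "tt (2 * n + 1)" and ?b = "tt (2 * n + 2)"
  have a: "?a \<ge> \<tau>" using times(3)[of n] tt_nonneg[of "2 * n"] by linarith
  obtain B where B: "continuous_on {?a..?b} B" "\<And>t. t \<in> {?a..<?b} \<Longrightarrow> B t = B2 t"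
    using B_cont(2)[of n] by (auto simp: cont_up_to_def)
  have "(\<lambda>t. (norm (adjoint (blinfun_apply (B t)) (z (t - \<tau>))))\<^sup>2) integrable_on {?a..?b}"
    using a by (intro integrable_continuous_real continuous_intros continuous_on_blinfun_adjoint B cont_z_delayed) auto
  then have "delay integrable_on {?a..?b}"
    by (rule integrable_spike_finite[of "{?b}", rotated 2]) (auto simp: delay_def B(2))
  then show ?thesis by (simp add: k)
qed

lemma delay_integrable:
  assumes "0 \<le> x" shows "delay integrable_on {x..y}"
proof -
  have "delay integrable_on {0..tt k}" for k
  proof (induction k)
    case 0
    then show ?case using integrable_on_refl[of delay 0] by (simp add: times(1))
  next
    case (Suc k)
    have "tt k \<le> tt (k + 1)" by (rule tt_le) simp
    from Henstock_Kurzweil_Integration.integrable_combine[OF tt_nonneg this Suc delay_integrable_piece]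
    show ?case by simp
  qed
  note * = this
  obtain n where "y \<le> tt (2 * n)" using tt_unbounded by blast
  then show ?thesis
    using assms by (intro integrable_on_subinterval[OF *[of "2 * n"]]) auto
qed

section \<open>Energy balance on undelayed and delayed intervals\<close>

lemma energy_eq: "E t = wave_energy S u z t + \<xi> / 2 * integral {t..t + \<tau>} delay"
proof -
  have "delay \<circ> (+) \<tau> = (\<lambda>s. (norm (adjoint (blinfun_apply (B2 (s + \<tau>))) (z s)))\<^sup>2)"
    by (auto simp: delay_def o_def add.commute)
  then show ?thesis
    using integral_shift_Icc_real[of "t - \<tau>" t delay \<tau>] by (simp add: energy_def wave_energy_def)
qed

lemma wave_energy_le: "t \<ge> 0 \<Longrightarrow> wave_energy S u z t \<le> E t"
  using xi(1) by (auto simp: energy_eq delay_nonneg intro!: mult_nonneg_nonneg integral_nonneg delay_integrable)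

lemma energy_nonneg: "t \<ge> 0 \<Longrightarrow> E t \<ge> 0"
  using wave_energy_le[of t] wave_energy_nonneg[of S u z t] by linarith

lemma delay_shift_integrable:
  assumes "0 \<le> s" shows "(\<lambda>r. delay (r + \<tau>)) integrable_on {s..t}"
proof -
  have "delay integrable_on {s + \<tau>..t + \<tau>}" using assms tau by (intro delay_integrable) simp
  then have "(delay has_integral integral {s + \<tau>..t + \<tau>} delay) {s + \<tau>..t + \<tau>}" by (rule integrable_integral)
  then have "((delay \<circ> (+) \<tau>) has_integral integral {s + \<tau>..t + \<tau>} delay) {s..t}"
    unfolding has_integral_shift_Icc_real .
  then show ?thesis by (auto simp: o_def add.commute)
qed

text \<open>Besides the work of the force, the moving window [r, r + \<tau>] gains
  \<open>delay (r + \<tau>)\<close> at its front and loses \<open>delay r\<close> at its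
  back.\<close>

lemma energy_step:
  assumes w: "weak_wave_on V S a b u z g" and st: "a \<le> s" "s \<le> t" "t \<le> b" "0 \<le> s"
  shows "E t - E s = integral {s..t} (\<lambda>r. g r \<bullet> z r)
    + \<xi> / 2 * (integral {s..t} (\<lambda>r. delay (r + \<tau>)) - integral {s..t} delay)"
proof -
  have c: "integral {p..q} delay = integral {0..q} delay - integral {0..p} delay" if "0 \<le> p" "p \<le> q" for p q
    using Henstock_Kurzweil_Integration.integral_combine[OF that delay_integrable] by simp
  have "integral {s..t} (\<lambda>r. delay (r + \<tau>)) = integral {s + \<tau>..t + \<tau>} delay"
    using integral_shift_Icc_real[of s t delay \<tau>] by (simp add: o_def add.commute)
  then have "integral {t..t + \<tau>} delay - integral {s..s + \<tau>} delay
      = integral {s..t} (\<lambda>r. delay (r + \<tau>)) - integral {s..t} delay"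
    using c[of t "t + \<tau>"] c[of s "s + \<tau>"] c[of "s + \<tau>" "t + \<tau>"] c[of s t] st tau by simp
  moreover have "wave_energy S u z t - wave_energy S u z s = integral {s..t} (\<lambda>r. g r \<bullet> z r)"
    using integral_unique[OF energy_identity[OF w st(1-3)]] by simp
  moreover have "E t - E s = (wave_energy S u z t - wave_energy S u z s)
      + \<xi> / 2 * (integral {t..t + \<tau>} delay - integral {s..s + \<tau>} delay)"
    by (simp add: energy_eq right_diff_distrib)
  ultimately show ?thesis by simp
qed

lemma force_integrable:
  assumes "weak_wave_on V S a b u z g" "a \<le> s" "t \<le> b"
  shows "(\<lambda>r. g r \<bullet> z r) integrable_on {s..t}"
proof (intro integrable_continuous_real continuous_intros)
  show "continuous_on {s..t} g" "continuous_on {s..t} z"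
    using assms by (auto simp: weak_wave_on_def intro: continuous_on_subset)
qed

text \<open>The force removes m_2n times the integral, and velocities entering the memory term
  return at most half of that; hence the factor 1/2.\<close>

lemma even_step:
  assumes st: "tt (2 * n) \<le> s" "s \<le> t" "t \<le> tt (2 * n + 1)"
  shows "E t \<le> E s - m (2 * n) / 2 * integral {s..t} (\<lambda>r. (norm (\<iota> (z r)))\<^sup>2)"
proof -
  obtain g where w: "weak_wave_on V S (tt (2 * n)) (tt (2 * n + 1)) u z g"
    and g: "\<forall>r\<in>{tt (2 * n)..tt (2 * n + 1)}. g r \<bullet> z r \<le> - m (2 * n) * (norm (\<iota> (z r)))\<^sup>2"
    using even_wave[of n] by blast
  have s0: "s \<ge> 0" using st tt_nonneg[of "2 * n"] by simp
  let ?I = "integral {s..t} (\<lambda>r. (norm (\<iota> (z r)))\<^sup>2)"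
  have ii: "(\<lambda>r. k * (norm (\<iota> (z r)))\<^sup>2) integrable_on {s..t}" for k
    using s0 by (intro integrable_continuous_real continuous_on_mult continuous_on_const cont_iota_z) auto
  have I: "?I \<ge> 0" using ii[of 1] by (intro integral_nonneg) auto
  have "integral {s..t} (\<lambda>r. g r \<bullet> z r) \<le> integral {s..t} (\<lambda>r. - m (2 * n) * (norm (\<iota> (z r)))\<^sup>2)"
    using st by (intro integral_le force_integrable[OF w] ii g[rule_format]) auto
  then have 1: "integral {s..t} (\<lambda>r. g r \<bullet> z r) \<le> - (m (2 * n) * ?I)" by simp
  have lt: "tt (2 * n + 1) < tt (2 * n + 2)" by (rule tt_less) simp
  have "integral {s..t} (\<lambda>r. delay (r + \<tau>)) \<le> integral {s..t} (\<lambda>r. M (2 * n + 1) * (norm (\<iota> (z r)))\<^sup>2)"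
    using st lt by (intro integral_le delay_shift_integrable s0 ii delay_shift) auto
  moreover have "integral {s..t} delay \<ge> 0" by (intro integral_nonneg delay_integrable s0 delay_nonneg)
  ultimately have "integral {s..t} (\<lambda>r. delay (r + \<tau>)) - integral {s..t} delay \<le> M (2 * n + 1) * ?I" by simp
  then have "\<xi> / 2 * (integral {s..t} (\<lambda>r. delay (r + \<tau>)) - integral {s..t} delay) \<le> \<xi> / 2 * (M (2 * n + 1) * ?I)"
    using xi(1) by (intro mult_left_mono) auto
  also have "\<dots> = \<xi> * M (2 * n + 1) * (?I / 2)" by simp
  also have "\<dots> \<le> m (2 * n) * (?I / 2)" using I by (intro mult_right_mono xi(2)) auto
  finally show ?thesis using 1 energy_step[OF w st s0] by (simp add: field_simps)
qed

text \<open>What the memory term releases cancels the delayed part of the force. Two contributions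
  remain: C M / (2 \<xi>) from the force and \<xi> C M / 2 from velocities newly entering the memory
  term.\<close>

lemma odd_step:
  assumes st: "tt (2 * n + 1) \<le> s" "s \<le> t" "t \<le> tt (2 * n + 2)"
  shows "E t \<le> E s + C * (1 / \<xi> + \<xi>) / 2 * M (2 * n + 1) * integral {s..t} (\<lambda>r. (norm (z r))\<^sup>2)"
proof -
  let ?M = "M (2 * n + 1)"
  obtain g where w: "weak_wave_on V S (tt (2 * n + 1)) (tt (2 * n + 2)) u z g"
    and g: "\<forall>r\<in>{tt (2 * n + 1)..<tt (2 * n + 2)}.
      g r \<bullet> z r \<le> \<xi> / 2 * delay r + C * ?M / (2 * \<xi>) * (norm (z r))\<^sup>2"
    using odd_wave[of n] by blast
  have s0: "s \<ge> 0" using st tt_nonneg[of "2 * n + 1"] by simp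
  let ?I = "integral {s..t} (\<lambda>r. (norm (z r))\<^sup>2)"
  have ii: "(\<lambda>r. k * (norm (z r))\<^sup>2) integrable_on {s..t}" for k
    using s0 by (intro integrable_continuous_real continuous_intros cont_z) auto
  have id: "(\<lambda>r. k * delay r) integrable_on {s..t}" for k
    using integrable_on_cmult_left[OF delay_integrable[OF s0, of t], of k] by simp
  have "integral {s..t} (\<lambda>r. g r \<bullet> z r) \<le>
      integral {s..t} (\<lambda>r. \<xi> / 2 * delay r + C * ?M / (2 * \<xi>) * (norm (z r))\<^sup>2)"
    using st by (intro integral_le_except_right force_integrable[OF w] integrable_add ii id g[rule_format]) auto
  also have "\<dots> = \<xi> / 2 * integral {s..t} delay + C * ?M / (2 * \<xi>) * ?I"
    by (subst integral_add[OF id ii]) simp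
  finally have 1: "integral {s..t} (\<lambda>r. g r \<bullet> z r) \<le> \<xi> / 2 * integral {s..t} delay + C * ?M / (2 * \<xi>) * ?I" .
  have lt: "tt (2 * n) < tt (2 * n + 1)" by (rule tt_less) simp
  have "integral {s..t} (\<lambda>r. delay (r + \<tau>)) \<le> integral {s..t} (\<lambda>r. (?M * C) * (norm (z r))\<^sup>2)"
  proof (intro integral_le_except_right delay_shift_integrable s0 ii)
    fix r assume "r \<in> {s..<t}"
    then have "delay (r + \<tau>) \<le> ?M * (norm (\<iota> (z r)))\<^sup>2" using st lt by (intro delay_shift) auto
    also have "\<dots> \<le> ?M * (C * (norm (z r))\<^sup>2)" using mM(3)[of n] by (intro mult_left_mono iota(3)) auto
    finally show "delay (r + \<tau>) \<le> (?M * C) * (norm (z r))\<^sup>2" by (simp add: mult.assoc)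
  qed
  then have 2: "\<xi> / 2 * integral {s..t} (\<lambda>r. delay (r + \<tau>)) \<le> \<xi> / 2 * (?M * C * ?I)"
    using xi(1) by (intro mult_left_mono) auto
  have "E t - E s \<le> C * ?M / (2 * \<xi>) * ?I + \<xi> / 2 * (?M * C * ?I)"
    using 1 2 energy_step[OF w st s0] by (simp add: right_diff_distrib)
  also have "\<dots> = C * (1 / \<xi> + \<xi>) / 2 * ?M * ?I" using xi(1) by (simp add: field_simps)
  finally show ?thesis by (simp only: diff_le_eq add.commute)
qed

end

section \<open>Decay\<close>

context switched_wave begin

text \<open>The window [t_2n, t_2n + \<tau>] fits into the undelayed interval, up to its right end.
  Observability, which sees the wave energy only, thus controls the full energy at these
  times.\<close>

lemma energy_at_even_time: "E (tt (2 * n)) = wave_energy S u z (tt (2 * n))"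
proof -
  have "(delay has_integral 0) {tt (2 * n)..tt (2 * n) + \<tau>}"
    by (rule has_integral_spike_finite[of "{tt (2 * n) + \<tau>}", OF _ _ has_integral_0])
      (use times(3)[of n] in \<open>auto intro!: delay_even[of _ n]\<close>)
  then show ?thesis by (simp add: energy_eq integral_unique)
qed

text \<open>\<open>T\<close> stays fixed while the interval length varies: both factors of the
  observability bound only grow when \<open>T\<close> is replaced by that length. The rate 1/(8 c)
  is the 1/2 of \<open>even_step\<close> divided by the 4 c of observability.\<close>

lemma even_decay:
  assumes c: "c > 0" and T: "T > 0" "T \<le> step_length tt (2 * n)"
    and obs: "\<And>w0 w1 w. w0 \<in> V \<Longrightarrow> free_wave_solution V S w0 w1 w \<Longrightarrow>
       1 / 2 * ((norm (S w0))\<^sup>2 + (norm w1)\<^sup>2) \<le>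
         c * integral {0..T} (\<lambda>s. (norm (\<iota> (time_deriv w s)))\<^sup>2)"
  shows "E (tt (2 * n + 1)) \<le>
    exp (- (1 / (8 * c) * (m (2 * n) / (1 + 4 * C\<^sup>2 * (step_length tt (2 * n))\<^sup>2 * (M (2 * n))\<^sup>2)))) * E (tt (2 * n))"
proof -
  let ?a = "tt (2 * n)" and ?b = "tt (2 * n + 1)" and ?f = "\<lambda>r. (norm (\<iota> (z r)))\<^sup>2"
  define D where "D = 1 + 4 * C\<^sup>2 * (step_length tt (2 * n))\<^sup>2 * (M (2 * n))\<^sup>2"
  have D: "D > 0" unfolding D_def by (intro add_pos_nonneg mult_nonneg_nonneg) auto
  define I where "I = integral {?a..?b} ?f"
  have Tb: "?a + T \<le> ?b" using T(2) by (simp add: step_length_def)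
  have a0: "0 \<le> ?a" by (rule tt_nonneg)
  have fi: "?f integrable_on {x..y}" if "0 \<le> x" for x y
    using that by (intro integrable_continuous_real cont_iota_z) auto
  obtain g where w: "weak_wave_on V S ?a ?b u z g"
    and g: "\<forall>r\<in>{?a..?b}. (norm (g r))\<^sup>2 \<le> C * (M (2 * n))\<^sup>2 * ?f r"
    using even_wave[of n] by blast
  have "wave_energy S u z ?a \<le>
      4 * c * (1 + 4 * C\<^sup>2 * T\<^sup>2 * (M (2 * n))\<^sup>2) * integral {?a..?a + T} ?f"
  proof (rule observability_perturbed[OF iota c T(1) obs])
    show "weak_wave_on V S ?a (?a + T) u z g" by (rule weak_wave_on_subinterval[OF w order_refl Tb])
    show "(norm (g r))\<^sup>2 \<le> C * (M (2 * n))\<^sup>2 * ?f r" if "r \<in> {?a..?a + T}" for r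
      using g that Tb by auto
  qed
  also have "\<dots> \<le> 4 * c * D * I"
  proof (rule mult_mono)
    have "C\<^sup>2 * T\<^sup>2 * (M (2 * n))\<^sup>2 \<le> C\<^sup>2 * (step_length tt (2 * n))\<^sup>2 * (M (2 * n))\<^sup>2"
      using T by (intro mult_right_mono mult_left_mono power_mono) auto
    then show "4 * c * (1 + 4 * C\<^sup>2 * T\<^sup>2 * (M (2 * n))\<^sup>2) \<le> 4 * c * D"
      unfolding D_def using c by (intro mult_left_mono) auto
    show "integral {?a..?a + T} ?f \<le> I"
      unfolding I_def using Tb a0 by (intro integral_subset_le fi) auto
    show "0 \<le> integral {?a..?a + T} ?f" by (intro integral_nonneg fi a0) auto
  qed (use c D in auto)
  finally have "E ?a \<le> 4 * c * D * I" unfolding energy_at_even_time .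
  then have "m (2 * n) / (8 * c * D) * E ?a \<le> m (2 * n) / (8 * c * D) * (4 * c * D * I)"
    using mM(1)[of n] c D by (intro mult_left_mono) auto
  also have "\<dots> = m (2 * n) / 2 * I" using c D by simp
  finally have le: "m (2 * n) / (8 * c * D) * E ?a \<le> m (2 * n) / 2 * I" .
  have "E ?b \<le> E ?a - m (2 * n) / 2 * I"
    unfolding I_def using times(2)[of "2 * n"] by (intro even_step) auto
  also have "\<dots> \<le> E ?a - m (2 * n) / (8 * c * D) * E ?a" by (rule diff_left_mono[OF le])
  also have "\<dots> = (1 - m (2 * n) / (8 * c * D)) * E ?a" by (simp only: left_diff_distrib mult_1)
  \<comment> \<open>The inequality 1 - x <= exp (- x) turns the product of contraction factors into
    a sum in the exponent.\<close>
  also have "\<dots> \<le> exp (- (m (2 * n) / (8 * c * D))) * E ?a"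
    using exp_ge_add_one_self[of "- (m (2 * n) / (8 * c * D))"]
    by (intro mult_right_mono energy_nonneg a0) auto
  finally show ?thesis by (simp add: D_def)
qed

text \<open>The memory term is nonnegative, so the full energy dominates the kinetic part and the
  estimate of \<open>odd_step\<close> closes under Gronwall.\<close>

lemma odd_growth:
  assumes t: "tt (2 * n + 1) \<le> t" "t \<le> tt (2 * n + 2)"
  shows "E t \<le> exp (C * (1 / \<xi> + \<xi>) * (M (2 * n + 1) * step_length tt (2 * n + 1))) * E (tt (2 * n + 1))"
proof -
  let ?a = "tt (2 * n + 1)" and ?K = "C * (1 / \<xi> + \<xi>) / 2 * M (2 * n + 1)"
  have K: "?K \<ge> 0" using iota(2) xi(1) mM(3)[of n] by simp
  have a0: "0 \<le> ?a" by (rule tt_nonneg)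
  have "E t \<le> exp (2 * ?K * (t - ?a)) * E ?a"
  proof (rule gronwall_energy[where b = "tt (2 * n + 2)" and p = "\<lambda>r. (norm (z r))\<^sup>2"])
    show "continuous_on {?a..tt (2 * n + 2)} (\<lambda>r. (norm (z r))\<^sup>2)"
      using a0 by (intro continuous_intros cont_z) auto
    show "E r \<le> E ?a + ?K * integral {?a..r} (\<lambda>r. (norm (z r))\<^sup>2)" if "r \<in> {?a..tt (2 * n + 2)}" for r
      using that by (intro odd_step) auto
    show "(norm (z r))\<^sup>2 \<le> 2 * E r" if "r \<in> {?a..tt (2 * n + 2)}" for r
      using norm_velocity_le_energy[of z r S u] wave_energy_le[of r] that a0 by auto
  qed (use t K in auto)
  also have "\<dots> \<le> exp (2 * ?K * step_length tt (2 * n + 1)) * E ?a"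
    using t K by (intro mult_right_mono energy_nonneg a0 iffD2[OF exp_le_cancel_iff] mult_left_mono)
      (auto simp: step_length_def)
  also have "2 * ?K * step_length tt (2 * n + 1)
      = C * (1 / \<xi> + \<xi>) * (M (2 * n + 1) * step_length tt (2 * n + 1))" by simp
  finally show ?thesis .
qed

lemma even_interval: 
  assumes "t \<ge> 0" obtains n where "tt (2 * n) \<le> t" "t < tt (2 * n + 2)"
proof -
  obtain n where "t + 1 \<le> tt (2 * n)" using tt_unbounded by blast
  then have ex: "\<exists>n. t < tt (2 * n)" by (intro exI[of _ n]) simp
  define k where "k = (LEAST n. t < tt (2 * n))"
  have k: "t < tt (2 * k)" unfolding k_def by (rule LeastI_ex[OF ex])
  have "k \<noteq> 0" using k assms times(1) by (intro notI) simp
  then obtain j where j: "k = Suc j" by (cases k) auto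
  have "\<not> t < tt (2 * j)" by (rule not_less_Least) (use j k_def in simp)
  then show ?thesis using that[of j] k j by simp
qed

theorem energy_tendsto_0:
  assumes c: "c > 0" and T: "T > 0" "\<And>n. T \<le> step_length tt (2 * n)"
    and obs: "\<And>w0 w1 w. w0 \<in> V \<Longrightarrow> free_wave_solution V S w0 w1 w \<Longrightarrow>
       1 / 2 * ((norm (S w0))\<^sup>2 + (norm w1)\<^sup>2) \<le>
         c * integral {0..T} (\<lambda>s. (norm (\<iota> (time_deriv w s)))\<^sup>2)"
    and sum_odd: "summable (\<lambda>n. M (2 * n + 1) * step_length tt (2 * n + 1))"
    and sum_even: "filterlim
        (\<lambda>N. \<Sum>n<N. m (2 * n) / (1 + 4 * C\<^sup>2 * (step_length tt (2 * n))\<^sup>2 * (M (2 * n))\<^sup>2))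
        at_top sequentially"
  shows "(E \<longlongrightarrow> 0) at_top"
proof -
  define K where "K = C * (1 / \<xi> + \<xi>)"
  have K: "K \<ge> 0" using iota(2) xi(1) by (simp add: K_def)
  define p where "p n = K * (M (2 * n + 1) * step_length tt (2 * n + 1))" for n
  define q where "q n = m (2 * n) / (1 + 4 * C\<^sup>2 * (step_length tt (2 * n))\<^sup>2 * (M (2 * n))\<^sup>2)" for n
  \<comment> \<open>\<open>P\<close> bounds the exponents of all delayed intervals together, so the
    divergent sum of \<open>q\<close> drives the total exponent to minus infinity.\<close>
  define P where "P = suminf p"
  have p0: "p n \<ge> 0" for n
    using K mM(3)[of n] times(2)[of "2 * n + 1"] by (simp add: p_def step_length_def)
  have sp: "summable p" unfolding p_def by (intro summable_mult sum_odd)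
  have pP: "sum p {..<n} \<le> P" for n
    unfolding P_def by (intro sum_le_suminf sp) (use p0 in auto)
  have p1: "p n \<le> P" for n
    using pP[of "Suc n"] sum_nonneg[of "{..<n}" p] p0 by simp
  have growth: "E t \<le> exp (p n) * E (tt (2 * n + 1))" if "tt (2 * n + 1) \<le> t" "t \<le> tt (2 * n + 2)" for n t
    using odd_growth[OF that] by (simp add: p_def K_def)
  have decay: "E (tt (2 * n + 1)) \<le> exp (- (1 / (8 * c) * q n)) * E (tt (2 * n))" for n
    unfolding q_def using even_decay[OF c T(1) T(2)] obs by blast
  have e0: "0 \<le> E (tt n)" for n by (intro energy_nonneg tt_nonneg)
  have step: "E (tt (2 * Suc n)) \<le> exp (p n - 1 / (8 * c) * q n) * E (tt (2 * n))" for n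
  proof -
    have "E (tt (2 * Suc n)) \<le> exp (p n) * E (tt (2 * n + 1))"
      using growth[of n "tt (2 * n + 2)"] tt_le[of "2 * n + 1" "2 * n + 2"] by simp
    also have "\<dots> \<le> exp (p n) * (exp (- (1 / (8 * c) * q n)) * E (tt (2 * n)))"
      by (intro mult_left_mono decay) simp
    also have "\<dots> = exp (p n + - (1 / (8 * c) * q n)) * E (tt (2 * n))"
      by (simp only: exp_add mult.assoc)
    finally show ?thesis by (simp only: diff_conv_add_uminus)
  qed
  have iter: "E (tt (2 * n)) \<le> exp (sum p {..<n} - 1 / (8 * c) * sum q {..<n}) * E (tt 0)" for n
  proof (induction n)
    case (Suc n)
    have "E (tt (2 * Suc n)) \<le> exp (p n - 1 / (8 * c) * q n) * E (tt (2 * n))" by (rule step)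
    also have "\<dots> \<le> exp (p n - 1 / (8 * c) * q n) *
        (exp (sum p {..<n} - 1 / (8 * c) * sum q {..<n}) * E (tt 0))"
      by (intro mult_left_mono Suc) simp
    also have "\<dots> = exp ((p n - 1 / (8 * c) * q n) + (sum p {..<n} - 1 / (8 * c) * sum q {..<n})) * E (tt 0)"
      by (simp add: exp_add)
    also have "(p n - 1 / (8 * c) * q n) + (sum p {..<n} - 1 / (8 * c) * sum q {..<n})
        = sum p {..<Suc n} - 1 / (8 * c) * sum q {..<Suc n}"
      by (simp add: algebra_simps add_divide_distrib)
    finally show ?case .
  qed simp
  define A where "A n = exp (P - 1 / (8 * c) * sum q {..<n}) * E (tt 0)" for n
  have EA: "E (tt (2 * n)) \<le> A n" for n
  proof -
    have "exp (sum p {..<n} - 1 / (8 * c) * sum q {..<n}) * E (tt 0) \<le> A n"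
      unfolding A_def using pP[of n] by (intro mult_right_mono e0) simp
    then show ?thesis using iter[of n] by linarith
  qed
  have Alim: "A \<longlonglongrightarrow> 0"
  proof -
    have "filterlim (\<lambda>n. sum q {..<n}) at_top sequentially"
      using sum_even by (simp add: q_def)
    then have "filterlim (\<lambda>n. 1 / (8 * c) * sum q {..<n}) at_top sequentially"
      using c by (intro filterlim_tendsto_pos_mult_at_top[OF tendsto_const]) auto
    then have "filterlim (\<lambda>n. - (1 / (8 * c) * sum q {..<n})) at_bot sequentially"
      by (simp add: filterlim_uminus_at_bot)
    then have "(\<lambda>n. exp (- (1 / (8 * c) * sum q {..<n}))) \<longlonglongrightarrow> 0"
      by (rule filterlim_compose[OF exp_at_bot])
    then have "(\<lambda>n. exp (- (1 / (8 * c) * sum q {..<n})) * (exp P * E (tt 0))) \<longlonglongrightarrow> 0"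
      by (rule tendsto_mult_left_zero)
    moreover have "A = (\<lambda>n. exp (- (1 / (8 * c) * sum q {..<n})) * (exp P * E (tt 0)))"
      by (simp only: A_def[abs_def] diff_conv_add_uminus exp_add mult_ac)
    ultimately show ?thesis by (simp only:)
  qed
  \<comment> \<open>Passing from even times to all times costs at most exp P: the energy does not
    increase on the undelayed interval and grows by at most exp (p n) on the following one.\<close>
  have bound: "E t \<le> exp P * A n" if t: "tt (2 * n) \<le> t" "t < tt (2 * n + 2)" for n t
  proof (cases "t \<le> tt (2 * n + 1)")
    case True
    have t0: "tt (2 * n) \<ge> 0" by (rule tt_nonneg)
    have "integral {tt (2 * n)..t} (\<lambda>r. (norm (\<iota> (z r)))\<^sup>2) \<ge> 0"
      using t0 by (intro integral_nonneg integrable_continuous_real cont_iota_z) auto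
    then have "m (2 * n) / 2 * integral {tt (2 * n)..t} (\<lambda>r. (norm (\<iota> (z r)))\<^sup>2) \<ge> 0"
      using mM(1)[of n] by (intro mult_nonneg_nonneg) auto
    then have "E t \<le> E (tt (2 * n))" using even_step[OF order_refl t(1) True] by linarith
    also have "\<dots> \<le> exp P * E (tt (2 * n))"
      using mult_right_mono[OF _ e0[of "2 * n"], of 1 "exp P"] p0[of 0] p1[of 0] by simp
    also have "\<dots> \<le> exp P * A n" by (intro mult_left_mono EA) simp
    finally show ?thesis .
  next
    case False
    have q0: "q n \<ge> 0" unfolding q_def using mM(1)[of n] by (intro divide_nonneg_nonneg add_nonneg_nonneg) auto
    have "E t \<le> exp (p n) * E (tt (2 * n + 1))" using growth[of n t] False t by simp
    also have "\<dots> \<le> exp P * E (tt (2 * n + 1))" using p1[of n] by (intro mult_right_mono e0) simp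
    also have "E (tt (2 * n + 1)) \<le> 1 * E (tt (2 * n))"
      using c q0 by (intro order_trans[OF decay mult_right_mono] e0) simp
    also have "1 * E (tt (2 * n)) \<le> A n" using EA by simp
    finally show ?thesis by simp
  qed
  show ?thesis
  proof (rule tendstoI)
    fix e :: real assume e: "e > 0"
    have "(\<lambda>n. exp P * A n) \<longlonglongrightarrow> 0" by (rule tendsto_mult_right_zero[OF Alim])
    then have "\<forall>\<^sub>F n in sequentially. exp P * A n < e" by (rule order_tendstoD(2)[OF _ e])
    then obtain N where N: "\<And>n. n \<ge> N \<Longrightarrow> exp P * A n < e" unfolding eventually_sequentially by blast
    have "dist (E t) 0 < e" if t: "t \<ge> tt (2 * N)" for t
    proof -
      have t0: "t \<ge> 0" using t tt_nonneg[of "2 * N"] by simp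
      obtain n where n: "tt (2 * n) \<le> t" "t < tt (2 * n + 2)" using even_interval[OF t0] .
      have "n \<ge> N"
      proof (rule ccontr)
        assume "\<not> n \<ge> N"
        then have "tt (2 * n + 2) \<le> tt (2 * N)" by (intro tt_le) simp
        then show False using t n by simp
      qed
      then have "E t < e" using bound[OF n] N[of n] by simp
      then show ?thesis using energy_nonneg[OF t0] by (simp add: dist_real_def)
    qed
    then show "\<forall>\<^sub>F t in at_top. dist (E t) 0 < e"
      unfolding eventually_at_top_linorder by blast
  qed
qed

end

lemma C1_up_to_imp_cont_up_to:
  assumes "C1_up_to a b f" shows "cont_up_to a b f"
proof -
  obtain g g' where d: "\<forall>t\<in>{a..b}. (g has_vector_derivative g' t) (at t within {a..b})"
    and g: "\<forall>t\<in>{a..<b}. g t = f t"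
    using assms unfolding C1_up_to_def by blast
  have "continuous_on {a..b} g" by (rule continuous_on_vector_derivative[OF d[rule_format]])
  with g show ?thesis unfolding cont_up_to_def by blast
qed

theorem theorem3p3:
  fixes D V :: "'h::{real_inner,complete_space} set"
    and A S :: "'h \<Rightarrow> 'h"
    and B1 :: "real \<Rightarrow> 'u1::{real_inner,complete_space} \<Rightarrow>\<^sub>L 'h"
    and B2 :: "real \<Rightarrow> 'u2::{real_inner,complete_space} \<Rightarrow>\<^sub>L 'h"
    and \<iota> :: "'h \<Rightarrow> 'w::{real_inner,complete_space}"
    and \<tau> \<xi> C Tbar :: real
    and tt m M :: "nat \<Rightarrow> real"
  assumes A: "self_adjoint_op D A" "positive_op D A" "has_compact_inverse D A"
    and S: "is_positive_sqrt_op V S D A"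
    and W: "bounded_linear \<iota>" "inj \<iota>" "C > 0" "\<And>v. (norm (\<iota> v))\<^sup>2 \<le> C * (norm v)\<^sup>2"
    and tau: "\<tau> > 0"
    and times: "tt 0 = 0" "\<And>n. tt n < tt (n + 1)" "\<And>n. step_length tt (2 * n) \<ge> \<tau>"
    and B_zero: "\<And>n t. t \<in> {tt (2 * n)..<tt (2 * n + 1)} \<Longrightarrow> B2 t = 0"
      "\<And>n t. t \<in> {tt (2 * n + 1)..<tt (2 * n + 2)} \<Longrightarrow> B1 t = 0"
    and B_reg: "\<And>n. C1_up_to (tt (2 * n)) (tt (2 * n + 1)) B1"
      "\<And>n. cont_up_to (tt (2 * n + 1)) (tt (2 * n + 2)) B2"
    and mM: "\<And>n. 0 < m (2 * n)" "\<And>n. m (2 * n) \<le> M (2 * n)" "\<And>n. 0 < M (2 * n + 1)"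
    and B1_bounds: "\<And>n t v. t \<in> {tt (2 * n)..<tt (2 * n + 1)} \<Longrightarrow>
        m (2 * n) * (norm (\<iota> v))\<^sup>2 \<le> (norm (adjoint (blinfun_apply (B1 t)) v))\<^sup>2 \<and>
        (norm (adjoint (blinfun_apply (B1 t)) v))\<^sup>2 \<le> M (2 * n) * (norm (\<iota> v))\<^sup>2"
    and B2_bound: "\<And>n t v. t \<in> {tt (2 * n + 1)..<tt (2 * n + 2)} \<Longrightarrow>
        (norm (adjoint (blinfun_apply (B2 t)) v))\<^sup>2 \<le> M (2 * n + 1) * (norm (\<iota> v))\<^sup>2"
    and ratio: "(INF n. m (2 * n) / M (2 * n + 1)) > 0"
    and xi: "0 < \<xi>" "\<xi> < (INF n. m (2 * n) / M (2 * n + 1))"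
    and Tbar: "Tbar > 0"
    and observability: "\<And>T. T > Tbar \<Longrightarrow> \<exists>c>0. \<forall>w0\<in>V. \<forall>w1 w.
        free_wave_solution V S w0 w1 w \<longrightarrow>
        1 / 2 * ((norm (S w0))\<^sup>2 + (norm w1)\<^sup>2) \<le>
          c * integral {0..T} (\<lambda>s. (norm (\<iota> (time_deriv w s)))\<^sup>2)"
    and Tstar: "(INF n. step_length tt (2 * n)) > Tbar" "(INF n. step_length tt (2 * n)) \<ge> \<tau>"
    and sum_odd: "summable (\<lambda>n. M (2 * n + 1) * step_length tt (2 * n + 1))"
    and sum_even: "filterlim
        (\<lambda>N. \<Sum>n<N. m (2 * n) / (1 + 4 * C\<^sup>2 * (step_length tt (2 * n))\<^sup>2 * (M (2 * n))\<^sup>2))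
        at_top sequentially"
  shows "\<forall>u0\<in>V. \<forall>u1 u. delayed_solution V S \<tau> tt B1 B2 u0 u1 u \<longrightarrow>
    ((\<lambda>t. energy S \<tau> \<xi> B2 u t) \<longlongrightarrow> 0) at_top"
proof (intro ballI allI impI)
  fix u0 u1 u
  assume u: "delayed_solution V S \<tau> tt B1 B2 u0 u1 u"
  \<comment> \<open>T* itself exceeds \<open>Tbar\<close> and fits into every undelayed interval, so
    one observability constant serves for all \<open>n\<close>.\<close>
  define T where "T = (INF n. step_length tt (2 * n))"
  \<comment> \<open>A real infimum is a lower bound only for a family bounded below; \<tau> provides
    the bound here, and 0 for the quotients in \<open>xi_le\<close>.\<close>
  have T: "T \<le> step_length tt (2 * n)" for n
    unfolding T_def by (rule cINF_lower) (use times(3) in \<open>auto intro!: bdd_belowI2[of _ \<tau>]\<close>)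
  have TT: "T > Tbar" using Tstar by (simp add: T_def)
  have xi_le: "\<xi> * M (2 * n + 1) \<le> m (2 * n)" for n
  proof -
    have "(INF n. m (2 * n) / M (2 * n + 1)) \<le> m (2 * n) / M (2 * n + 1)"
      by (rule cINF_lower) (use mM in \<open>auto intro!: bdd_belowI2[of _ 0] divide_nonneg_pos less_imp_le\<close>)
    then have "\<xi> \<le> m (2 * n) / M (2 * n + 1)" using xi(2) by linarith
    then show ?thesis using mM(3)[of n] by (simp add: pos_le_divide_eq)
  qed
  interpret compact_resolvent V S "\<lambda>x. S (inv_into D A x)"
    by (rule compact_resolvent_sqrt[OF A(1,3) S])
  have B1_cont: "cont_up_to (tt (2 * n)) (tt (2 * n + 1)) B1" for n
    by (rule C1_up_to_imp_cont_up_to[OF B_reg(1)])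
  interpret switched_wave V S "\<lambda>x. S (inv_into D A x)" \<iota> C \<tau> \<xi> tt m M B1 B2 u
  proof (intro switched_wave.intro switched_wave_axioms.intro compact_resolvent_axioms)
    show "tt (2 * n) + \<tau> \<le> tt (2 * n + 1)" for n
      using times(3)[of n] by (simp add: step_length_def)
    show "energy_class V S u" using u by (simp add: delayed_solution_def)
    fix t :: real
    assume "t > 0" "t \<notin> range tt"
    then show "has_dual_derivative V S (time_deriv u)
          (\<lambda>v. - inner (S (u t)) (S v)
               - inner (blinfun_apply (B1 t) (adjoint (blinfun_apply (B1 t)) (time_deriv u t))) v
               - inner (blinfun_apply (B2 t) (adjoint (blinfun_apply (B2 t)) (time_deriv u (t - \<tau>)))) v) t"
      using u unfolding delayed_solution_def by blast
  qed (fact W tau times B_zero B1_cont B_reg mM xi xi_le B1_bounds B2_bound)+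
  obtain c where c: "c > 0" "\<forall>w0\<in>V. \<forall>w1 w. free_wave_solution V S w0 w1 w \<longrightarrow>
        1 / 2 * ((norm (S w0))\<^sup>2 + (norm w1)\<^sup>2) \<le>
          c * integral {0..T} (\<lambda>s. (norm (\<iota> (time_deriv w s)))\<^sup>2)"
    using observability[OF TT] by blast
  show "(energy S \<tau> \<xi> B2 u \<longlongrightarrow> 0) at_top"
    by (rule energy_tendsto_0[OF c(1) _ T _ sum_odd sum_even]) (use c(2) TT Tbar in auto)
qed

end
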